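(* Let $n$ be the number of vertices of the input graph and $k$ the input integer with $k\le 0.021n^3$, and put $\theta=\sqrt{k/n}$. Then Min-Square 2-Clustering can be solved in $O\!\left(n^3\cdot 5.171^{\,\theta/(1-(4+2\sqrt{2})\theta/n)}\right)$ time.
   Context: Let $G=(V,E)$ be a simple undirected graph with $n=|V|$. A 2-partition of $V$ is an unordered pair $\pi=(V_1,V_2)$ with $V_1\cap V_2=\emptyset$ and $V_1\cup V_2=V$. Two distinct vertices $u,v$ are in conflict in $\pi$ if they lie in the same cluster and $(u,v)\notin E$, or they lie in different clusters and $(u,v)\in E$. The conflict number $c_\pi(v)$ is the number of vertices in conflict with $v$. Let $h_2(\pi)=\sum_{v\in V}c_\pi(v)^2$. Min-Square 2-Clustering: given $G$ and a nonnegative integer $k$, decide whether there is a 2-partition $\pi=(V_1,V_2)$ with $V_1,V_2\neq\emptyset$ and $h_2(\pi)\le k$. *)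

theory Defs
  imports Complex_Main
begin

section \<open>Min-Square 2-Clustering\<close>

definition simple_graph :: "'a set \<Rightarrow> 'a set set \<Rightarrow> bool" where
  "simple_graph V E \<longleftrightarrow> finite V \<and> (\<forall>e\<in>E. e \<subseteq> V \<and> card e = 2)"

text \<open>Partitions are represented by ordered pairs. All notions below are symmetric in
  \<open>V1\<close> and \<open>V2\<close>, so nothing depends on the order.\<close>

definition two_partition :: "'a set \<Rightarrow> 'a set \<Rightarrow> 'a set \<Rightarrow> bool" where
  "two_partition V V1 V2 \<longleftrightarrow> V1 \<inter> V2 = {} \<and> V1 \<union> V2 = V"

definition in_conflict :: "'a set set \<Rightarrow> 'a set \<Rightarrow> 'a set \<Rightarrow> 'a \<Rightarrow> 'a \<Rightarrow> bool" where
  "in_conflict E V1 V2 u v \<longleftrightarrow> u \<noteq> v \<and>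
     (((u \<in> V1 \<and> v \<in> V1 \<or> u \<in> V2 \<and> v \<in> V2) \<and> {u, v} \<notin> E) \<or>
      ((u \<in> V1 \<and> v \<in> V2 \<or> u \<in> V2 \<and> v \<in> V1) \<and> {u, v} \<in> E))"

definition conflict_number :: "'a set \<Rightarrow> 'a set set \<Rightarrow> 'a set \<Rightarrow> 'a set \<Rightarrow> 'a \<Rightarrow> nat" where
  "conflict_number V E V1 V2 v = card {u \<in> V. in_conflict E V1 V2 u v}"

definition h2 :: "'a set \<Rightarrow> 'a set set \<Rightarrow> 'a set \<Rightarrow> 'a set \<Rightarrow> nat" where
  "h2 V E V1 V2 = (\<Sum>v\<in>V. (conflict_number V E V1 V2 v)\<^sup>2)"

definition min_square_2_clustering :: "'a set \<Rightarrow> 'a set set \<Rightarrow> nat \<Rightarrow> bool" where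
  "min_square_2_clustering V E k \<longleftrightarrow>
     (\<exists>V1 V2. two_partition V V1 V2 \<and> V1 \<noteq> {} \<and> V2 \<noteq> {} \<and> h2 V E V1 V2 \<le> k)"


section \<open>A word RAM\<close>

text \<open>Running time is the number of executed instructions of a structured word-RAM program.
  A program addresses finitely many registers by name and an indexed memory indirectly
  through registers. All words are natural numbers below a bound \<open>W\<close>, the number of
  words; an instruction whose result would not fit into a word has no execution.
  Subtraction is truncated at 0.\<close>

datatype instr =
    Const nat nat
  | Add nat nat nat
  | Sub nat nat nat
  | Mul nat nat nat
  | Load nat nat
  | Store nat nat

datatype prog =
    Skip
  | Do instr
  | Seq prog prog
  | IfLess nat nat prog prog
  | WhileLess nat nat prog

record state =
  regs :: "nat \<Rightarrow> nat"
  mem :: "nat \<Rightarrow> nat"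

fun set_reg :: "nat \<Rightarrow> nat \<Rightarrow> state \<Rightarrow> state" where
  "set_reg r x s = s\<lparr>regs := (regs s)(r := x)\<rparr>"

inductive exec_instr :: "nat \<Rightarrow> instr \<Rightarrow> state \<Rightarrow> state \<Rightarrow> bool" for W :: nat where
  Const: "c < W \<Longrightarrow> exec_instr W (Const r c) s (set_reg r c s)"
| Add: "regs s a + regs s b < W \<Longrightarrow>
    exec_instr W (Add r a b) s (set_reg r (regs s a + regs s b) s)"
| Sub: "exec_instr W (Sub r a b) s (set_reg r (regs s a - regs s b) s)"
| Mul: "regs s a * regs s b < W \<Longrightarrow>
    exec_instr W (Mul r a b) s (set_reg r (regs s a * regs s b) s)"
| Load: "exec_instr W (Load r a) s (set_reg r (mem s (regs s a)) s)"
| Store: "exec_instr W (Store a b) s (s\<lparr>mem := (mem s)(regs s a := regs s b)\<rparr>)"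

text \<open>\<open>exec W p s t s'\<close>: with word bound \<open>W\<close>, program \<open>p\<close> started in state \<open>s\<close> halts after
  exactly \<open>t\<close> steps in state \<open>s'\<close>. Every instruction and every evaluation of a test is one
  step.\<close>

inductive exec :: "nat \<Rightarrow> prog \<Rightarrow> state \<Rightarrow> nat \<Rightarrow> state \<Rightarrow> bool" for W :: nat where
  Skip: "exec W Skip s 1 s"
| Do: "exec_instr W i s s' \<Longrightarrow> exec W (Do i) s 1 s'"
| Seq: "exec W p s t s' \<Longrightarrow> exec W q s' t' s'' \<Longrightarrow> exec W (Seq p q) s (t + t') s''"
| IfTrue: "regs s a < regs s b \<Longrightarrow> exec W p s t s' \<Longrightarrow>
    exec W (IfLess a b p q) s (1 + t) s'"
| IfFalse: "\<not> regs s a < regs s b \<Longrightarrow> exec W q s t s' \<Longrightarrow>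
    exec W (IfLess a b p q) s (1 + t) s'"
| WhileTrue: "regs s a < regs s b \<Longrightarrow> exec W p s t s' \<Longrightarrow>
    exec W (WhileLess a b p) s' t' s'' \<Longrightarrow> exec W (WhileLess a b p) s (1 + t + t') s''"
| WhileFalse: "\<not> regs s a < regs s b \<Longrightarrow> exec W (WhileLess a b p) s 1 s"

inductive_cases exec_instr_elims:
  "exec_instr W (Const r c) s s'" "exec_instr W (Add r a b) s s'"
  "exec_instr W (Sub r a b) s s'" "exec_instr W (Mul r a b) s s'"
  "exec_instr W (Load r a) s s'" "exec_instr W (Store a b) s s'"

lemma exec_instr_deterministic:
  "exec_instr W i s s' \<Longrightarrow> exec_instr W i s s'' \<Longrightarrow> s'' = s'"
  by (cases i) (auto elim!: exec_instr_elims)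

lemma exec_deterministic:
  "exec W p s t s' \<Longrightarrow> exec W p s u s'' \<Longrightarrow> u = t \<and> s'' = s'"
proof (induction arbitrary: u s'' rule: exec.induct)
  case (Skip s)
  from Skip.prems show ?case by cases auto
next
  case (Do i s s')
  from Do.prems show ?case
    by cases (use Do.hyps exec_instr_deterministic in blast)
next
  case (Seq p s t s1 q t' s2)
  from Seq.prems show ?case by cases (use Seq.IH in blast)
next
  case (IfTrue s a b p t s' q)
  from IfTrue.prems show ?case by cases (use IfTrue.hyps IfTrue.IH in blast)+
next
  case (IfFalse s a b q t s' p)
  from IfFalse.prems show ?case by cases (use IfFalse.hyps IfFalse.IH in blast)+
next
  case (WhileTrue s a b p t s1 t' s2)
  from WhileTrue.prems show ?case by cases (use WhileTrue.hyps WhileTrue.IH in blast)+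
next
  case (WhileFalse s a b p)
  from WhileFalse.prems show ?case by cases (use WhileFalse.hyps in auto)
qed

text \<open>An instance on the vertex set \<open>{0..<n}\<close> is given by \<open>n\<close> in register 0, \<open>k\<close> in register 1,
  and the adjacency matrix, row by row, in the memory cells below \<open>n\<^sup>2\<close>; everything else is 0.\<close>

definition input_state :: "nat \<Rightarrow> nat set set \<Rightarrow> nat \<Rightarrow> state" where
  "input_state n E k =
     \<lparr>regs = (\<lambda>_. 0)(0 := n, 1 := k),
      mem = (\<lambda>i. if i < n * n \<and> {i div n, i mod n} \<in> E then 1 else 0)\<rparr>"

text \<open>The answer is read off register 0 (1 for yes, 0 for no). The initial contents have to be
  words as well.\<close>

definition decides_within :: "nat \<Rightarrow> prog \<Rightarrow> state \<Rightarrow> bool \<Rightarrow> real \<Rightarrow> bool" where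
  "decides_within W p s ans T \<longleftrightarrow>
     (\<forall>i. regs s i < W \<and> mem s i < W) \<and>
     (\<exists>t s'. exec W p s t s' \<and> regs s' 0 = (if ans then 1 else 0) \<and> real t \<le> T)"

end

theory Submission imports Defs begin

text \<open>If \<open>h2 \<le> k\<close>, some vertex \<open>v\<close> has at most \<open>\<theta>\<close> conflicts, so the partition into the closed
  neighbourhood of \<open>v\<close> and the rest is correct up to at most \<open>\<theta>\<close> vertices. Moving every vertex that
  is in conflict with at least half of the others leaves only errors at vertices with at least
  \<open>n/2 - \<theta>\<close> conflicts in the wanted partition, and as \<open>\<theta> \<le> 0.145 n\<close> there are at most \<open>8 k / n\<^sup>2\<close>
  of them. All sets of at most this size are tried, in time \<open>O(n\<^sup>2)\<close> each. With \<open>x = \<theta> / n\<close> their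
  number \<open>N\<close> satisfies \<open>ln N \<le> \<theta> (1 + 8 x ln (1/x))\<close>, because the weights \<open>x ^ card X\<close> of all
  \<open>X\<close> add up to \<open>(1 + x) ^ n\<close>.\<close>

section \<open>Weakest preconditions with running time\<close>

text \<open>The machine computes neither roots nor quotients. So \<open>\<theta>\<close> never
  occurs in the program: every \<open>v\<close> is tried, and the size limit is the integer
  inequality \<open>card X * (n * n) \<le> 8 * k\<close>, kept as a budget from which each chosen
  vertex takes \<open>n * n\<close>. The sets are run through by a binary counter that skips heavy
  sets and finds the next light one from the current one alone, without recursion. The estimate of
  \<open>N\<close> explains the base. Near \<open>x = 0\<close> the term
  \<open>8 * x * ln (1 / x)\<close> exceeds every multiple of \<open>x\<close>, so the denominator
  \<open>1 - (4 + 2 * sqrt 2) * x\<close> cannot absorb it with base e. A larger base leaves room: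
  1.56 in place of 1 suffices for all \<open>x \<le> 0.145\<close>, and \<open>ln 5.171\<close> is
  about 1.643. The same limit 0.145 keeps the denominator positive.\<close>

definition wp :: "nat \<Rightarrow> prog \<Rightarrow> (nat \<Rightarrow> state \<Rightarrow> bool) \<Rightarrow> state \<Rightarrow> bool" where
  "wp W p Q s \<longleftrightarrow> (\<exists>t s'. exec W p s t s' \<and> Q t s')"

text \<open>The congruence rule stops the simplifier from executing the continuation on a symbolic
  state before the current instruction has been executed.\<close>

lemma wp_weak_cong [cong]: "s = s' \<Longrightarrow> wp W p Q s = wp W p Q s'"
  by simp

lemma wp_mono: "wp W p Q s \<Longrightarrow> (\<And>t s'. Q t s' \<Longrightarrow> R t s') \<Longrightarrow> wp W p R s"
  unfolding wp_def by blast

inductive_cases exec_elims: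
  "exec W Skip s t s'" "exec W (Do i) s t s'" "exec W (Seq p q) s t s'"
  "exec W (IfLess a b p q) s t s'"

text \<open>By determinism the known run is the only one. The rules thus become equations, and the
  simplifier can run straight-line code symbolically.\<close>

lemma wp_if_exec: "exec W p s t s' \<Longrightarrow> wp W p Q s \<longleftrightarrow> Q t s'"
  unfolding wp_def using exec_deterministic by blast

lemmas wp_Skip = wp_if_exec[OF exec.Skip]

lemma wp_Seq: "wp W (Seq p q) Q s \<longleftrightarrow> wp W p (\<lambda>t. wp W q (\<lambda>t'. Q (t + t'))) s"
proof
  assume "wp W (Seq p q) Q s"
  then show "wp W p (\<lambda>t. wp W q (\<lambda>t'. Q (t + t'))) s"
    unfolding wp_def by (auto elim!: exec_elims)
next
  assume "wp W p (\<lambda>t. wp W q (\<lambda>t'. Q (t + t'))) s"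
  then show "wp W (Seq p q) Q s"
    unfolding wp_def using exec.Seq by blast
qed

lemma wp_IfLess:
  "wp W (IfLess a b p q) Q s \<longleftrightarrow>
     (if regs s a < regs s b then wp W p (\<lambda>t. Q (1 + t)) s else wp W q (\<lambda>t. Q (1 + t)) s)"
proof (cases "regs s a < regs s b")
  case True
  have "exec W (IfLess a b p q) s t s' \<longleftrightarrow> (\<exists>t'. t = 1 + t' \<and> exec W p s t' s')" for t s'
  proof
    assume "exec W (IfLess a b p q) s t s'"
    then show "\<exists>t'. t = 1 + t' \<and> exec W p s t' s'"
      by (rule exec_elims) (use True in auto)
  qed (use exec.IfTrue[OF True] in blast)
  then show ?thesis using True unfolding wp_def by auto
next
  case False
  have "exec W (IfLess a b p q) s t s' \<longleftrightarrow> (\<exists>t'. t = 1 + t' \<and> exec W q s t' s')" for t s'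
  proof
    assume "exec W (IfLess a b p q) s t s'"
    then show "\<exists>t'. t = 1 + t' \<and> exec W q s t' s'"
      by (rule exec_elims) (use False in auto)
  qed (use exec.IfFalse[OF False] in blast)
  then show ?thesis using False unfolding wp_def by auto
qed

lemma wp_Do: "wp W (Do i) Q s \<longleftrightarrow> (\<exists>s'. exec_instr W i s s' \<and> Q 1 s')"
proof
  assume "wp W (Do i) Q s"
  then show "\<exists>s'. exec_instr W i s s' \<and> Q 1 s'"
    unfolding wp_def by (auto elim!: exec_elims)
next
  assume "\<exists>s'. exec_instr W i s s' \<and> Q 1 s'"
  then show "wp W (Do i) Q s"
    unfolding wp_def using exec.Do by blast
qed

lemma wp_Const:
  "wp W (Do (Const r c)) Q s \<longleftrightarrow> c < W \<and> Q 1 (set_reg r (c) s)"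
  unfolding wp_Do
proof
  assume "\<exists>s'. exec_instr W (Const r c) s s' \<and> Q 1 s'"
  then show "c < W \<and> Q 1 (set_reg r (c) s)"
    by (auto elim!: exec_instr_elims)
qed (use exec_instr.Const in blast)

lemma wp_Add:
  "wp W (Do (Add r a b)) Q s \<longleftrightarrow> regs s a + regs s b < W \<and> Q 1 (set_reg r (regs s a + regs s b) s)"
  unfolding wp_Do
proof
  assume "\<exists>s'. exec_instr W (Add r a b) s s' \<and> Q 1 s'"
  then show "regs s a + regs s b < W \<and> Q 1 (set_reg r (regs s a + regs s b) s)"
    by (auto elim!: exec_instr_elims)
qed (use exec_instr.Add in blast)

lemma wp_Mul:
  "wp W (Do (Mul r a b)) Q s \<longleftrightarrow> regs s a * regs s b < W \<and> Q 1 (set_reg r (regs s a * regs s b) s)"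
  unfolding wp_Do
proof
  assume "\<exists>s'. exec_instr W (Mul r a b) s s' \<and> Q 1 s'"
  then show "regs s a * regs s b < W \<and> Q 1 (set_reg r (regs s a * regs s b) s)"
    by (auto elim!: exec_instr_elims)
qed (use exec_instr.Mul in blast)

lemmas wp_instr = wp_Const wp_Add wp_Mul
  wp_if_exec[OF exec.Do[OF exec_instr.Sub]] wp_if_exec[OF exec.Do[OF exec_instr.Load]]
  wp_if_exec[OF exec.Do[OF exec_instr.Store]]

text \<open>One measure gives both termination and time: an iteration lowers \<open>\<mu>\<close>
  and costs at most \<open>T\<close> plus its test; the final 1 is the failing test.\<close>

lemma wp_WhileLess:
  fixes \<mu> :: "state \<Rightarrow> nat"
  assumes "I s"
    and step: "\<And>s. I s \<Longrightarrow> regs s a < regs s b \<Longrightarrow>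
      wp W p (\<lambda>t s'. t \<le> T \<and> I s' \<and> \<mu> s' < \<mu> s) s"
  shows "wp W (WhileLess a b p)
    (\<lambda>t s'. t \<le> \<mu> s * (T + 1) + 1 \<and> I s' \<and> \<not> regs s' a < regs s' b) s"
  using \<open>I s\<close>
proof (induction "\<mu> s" arbitrary: s rule: less_induct)
  case less
  show ?case
  proof (cases "regs s a < regs s b")
    case False
    then show ?thesis
      using less.prems unfolding wp_def by (fastforce intro: exec.WhileFalse)
  next
    case True
    from step[OF less.prems True] obtain t s1
      where 1: "exec W p s t s1" "t \<le> T" "I s1" "\<mu> s1 < \<mu> s"
      unfolding wp_def by blast
    from less.hyps[OF 1(4) 1(3)] obtain t' s2
      where 2: "exec W (WhileLess a b p) s1 t' s2" "t' \<le> \<mu> s1 * (T + 1) + 1"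
        "I s2" "\<not> regs s2 a < regs s2 b"
      unfolding wp_def by blast
    have "Suc (\<mu> s1) * (T + 1) \<le> \<mu> s * (T + 1)"
      using 1(4) by (intro mult_right_mono) auto
    then have "1 + t + t' \<le> \<mu> s * (T + 1) + 1"
      using 1(2) 2(2) by simp
    then show ?thesis
      unfolding wp_def using exec.WhileTrue[OF True 1(1) 2(1)] 2(3,4) by blast
  qed
qed

text \<open>The closing \<open>Skip\<close> costs a step, so a block of m instructions takes m + 1
  steps.\<close>

fun block :: "prog list \<Rightarrow> prog" where
  "block [] = Skip"
| "block (p # ps) = Seq p (block ps)"

lemmas wp_simps = wp_Skip wp_Seq wp_IfLess wp_instr

section \<open>Conflicts with respect to a similarity relation\<close>

text \<open>The case \<open>w = u\<close> is not excluded: for a reflexive \<open>a\<close> a vertex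
  is never in conflict with itself, and the program needs no extra test.\<close>

definition conflicts :: "nat \<Rightarrow> (nat \<Rightarrow> nat \<Rightarrow> bool) \<Rightarrow> (nat \<Rightarrow> bool) \<Rightarrow> nat \<Rightarrow> nat" where
  "conflicts n a p u = card {w. w < n \<and> (p u = p w) \<noteq> a u w}"

definition good :: "nat \<Rightarrow> (nat \<Rightarrow> nat \<Rightarrow> bool) \<Rightarrow> nat \<Rightarrow> (nat \<Rightarrow> bool) \<Rightarrow> bool" where
  "good n a k p \<longleftrightarrow> (\<Sum>u<n. (conflicts n a p u)\<^sup>2) \<le> k \<and> (\<exists>u<n. p u) \<and> (\<exists>u<n. \<not> p u)"

definition majority :: "nat \<Rightarrow> (nat \<Rightarrow> nat \<Rightarrow> bool) \<Rightarrow> nat \<Rightarrow> nat \<Rightarrow> bool" where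
  "majority n a v u \<longleftrightarrow> (a v u \<noteq> (n \<le> 2 * conflicts n a (a v) u))"

definition flip :: "(nat \<Rightarrow> bool) \<Rightarrow> nat set \<Rightarrow> nat \<Rightarrow> bool" where
  "flip p X u \<longleftrightarrow> (p u \<noteq> (u \<in> X))"

text \<open>The product form replaces the bound \<open>K / n^2\<close> on the size, so that the
  program can test it without division.\<close>

definition light :: "nat \<Rightarrow> nat \<Rightarrow> nat set \<Rightarrow> bool" where
  "light n K X \<longleftrightarrow> X \<subseteq> {..<n} \<and> card X * (n * n) \<le> K"

lemma finite_light: "light n K X \<Longrightarrow> finite X"
  unfolding light_def using finite_subset by blast

lemma light_mono: "light n K X \<Longrightarrow> Y \<subseteq> X \<Longrightarrow> light n K Y"
  unfolding light_def
  by (meson card_mono finite_lessThan finite_subset mult_le_mono1 order_trans)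

definition light_sets :: "nat \<Rightarrow> nat \<Rightarrow> nat set set" where
  "light_sets n K = {Z. light n K Z}"

lemma finite_light_sets: "finite (light_sets n K)"
proof (rule finite_subset)
  show "light_sets n K \<subseteq> Pow {..<n}" by (auto simp: light_sets_def light_def)
qed simp

text \<open>The empty set is always light. This lets additive costs be absorbed into multiples of
  the number of light sets.\<close>

lemma card_light_sets_pos: "0 < card (light_sets n K)"
proof -
  have "{} \<in> light_sets n K" by (simp add: light_sets_def light_def)
  then show ?thesis using finite_light_sets card_gt_0_iff by blast
qed

lemma flip_empty: "flip q {} = q"
  by (simp add: flip_def fun_eq_iff)

lemma flip_change:
  assumes "\<And>j. j \<noteq> i \<Longrightarrow> j \<in> S' \<longleftrightarrow> j \<in> S" "i \<in> S' \<longleftrightarrow> i \<notin> S"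
  shows "flip q S' = (flip q S)(i := \<not> flip q S i)" "(\<lambda>u. u \<in> S') = (\<lambda>u. u \<in> S)(i := i \<notin> S)"
  using assms by (auto simp: flip_def fun_eq_iff)

lemma conflicts_le: "conflicts n a p u \<le> n"
proof -
  have "card {w. w < n \<and> (p u = p w) \<noteq> a u w} \<le> card {..<n}"
    by (intro card_mono) auto
  then show ?thesis by (simp add: conflicts_def)
qed

text \<open>The row of \<open>v\<close> differs from the wanted partition exactly on the conflict set \<open>F\<close> of \<open>v\<close>.
  So a vertex on which the majority vote errs has at least \<open>n/2 - |F|\<close> conflicts.\<close>

lemma majority_error:
  assumes "p v" and u: "u < n" "majority n a v u \<noteq> p u"
  shows "n \<le> 2 * conflicts n a p u + 2 * conflicts n a p v"
proof -
  define F where "F = {w. w < n \<and> (p v = p w) \<noteq> a v w}"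
  define C where "C = {w. w < n \<and> (p u = p w) \<noteq> a u w}"
  define P where "P = {w. w < n \<and> (a v u = a v w) \<noteq> a u w}"
  have fin: "finite F" "finite C" "finite P"
    by (auto simp: F_def C_def P_def)
  have FC: "card (C \<union> F) \<le> card C + card F" by (rule card_Un_le)
  show ?thesis
  proof (cases "u \<in> F")
    case False
    \<comment> \<open>The row is right at \<open>u\<close>, so the vote erred by moving
      \<open>u\<close>. Outside \<open>F\<close> the row agrees with \<open>p\<close>, hence
      \<open>P\<close> and \<open>C\<close> coincide there.\<close>
    then have "n \<le> 2 * card P"
      using u \<open>p v\<close> by (auto simp: majority_def F_def P_def conflicts_def)
    moreover have "P \<subseteq> C \<union> F"
      using False u(1) \<open>p v\<close> by (auto simp: F_def P_def C_def)
    then have "card P \<le> card (C \<union> F)" using fin by (intro card_mono) auto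
    ultimately show ?thesis using FC by (simp add: conflicts_def F_def C_def)
  next
    case True
    \<comment> \<open>The row is wrong at \<open>u\<close> and the vote kept it. Every comparison
      with \<open>u\<close> is now inverted outside \<open>F\<close>, so the complement of
      \<open>P\<close> takes the place of \<open>P\<close>.\<close>
    then have "2 * card P < n"
      using u \<open>p v\<close> by (auto simp: majority_def F_def P_def conflicts_def)
    moreover have "{..<n} - P \<subseteq> C \<union> F"
      using True u(1) \<open>p v\<close> by (auto simp: F_def P_def C_def)
    then have "card ({..<n} - P) \<le> card (C \<union> F)" using fin by (intro card_mono) auto
    moreover have "card ({..<n} - P) = n - card P"
      by (subst card_Diff_subset) (auto simp: P_def)
    ultimately show ?thesis using FC by (simp add: conflicts_def F_def C_def)
  qed
qed

lemma conflicts_cong: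
  "(\<And>w. w < n \<Longrightarrow> p w = q w) \<Longrightarrow> u < n \<Longrightarrow> conflicts n a p u = conflicts n a q u"
  unfolding conflicts_def by (rule arg_cong[of _ _ card]) auto

lemma conflicts_iff: "conflicts n a (\<lambda>u. p u = c) = conflicts n a p"
proof
  fix u
  have "{w. w < n \<and> ((p u = c) = (p w = c)) \<noteq> a u w} = {w. w < n \<and> (p u = p w) \<noteq> a u w}"
    by (cases c) auto
  then show "conflicts n a (\<lambda>u. p u = c) u = conflicts n a p u"
    by (simp only: conflicts_def)
qed

lemma good_iff: "good n a k (\<lambda>u. p u = c) \<longleftrightarrow> good n a k p"
  unfolding good_def conflicts_iff by (cases c) auto

lemma exists_light_correction:
  assumes "n > 0" "good n a k p" and k: "real k \<le> 0.021 * real n ^ 3"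
  shows "\<exists>v<n. \<exists>X. light n (8 * k) X \<and> good n a k (flip (majority n a v) X)"
proof -
  have sum: "(\<Sum>u<n. (conflicts n a p u)\<^sup>2) \<le> k"
    using assms(2) by (simp add: good_def)
  have "\<exists>v<n. n * (conflicts n a p v)\<^sup>2 \<le> k"
  proof (rule ccontr)
    assume "\<not> ?thesis"
    then have "\<And>v. v < n \<Longrightarrow> k < n * (conflicts n a p v)\<^sup>2" by force
    then have "(\<Sum>v<n. k) < (\<Sum>v<n. n * (conflicts n a p v)\<^sup>2)"
      using \<open>n > 0\<close> by (intro sum_strict_mono) auto
    then show False
      using sum by (simp flip: sum_distrib_left)
  qed
  then obtain v where v: "v < n" "n * (conflicts n a p v)\<^sup>2 \<le> k" by blast
  define c where "c = conflicts n a p v"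
  \<comment> \<open>\<open>majority_error\<close> wants \<open>v\<close> on the true side.
    Complementing the partition if necessary achieves this and leaves all conflicts
    unchanged.\<close>
  define q where "q = (\<lambda>u. p u = p v)"
  have cq: "conflicts n a q = conflicts n a p" unfolding q_def by (rule conflicts_iff)
  define X where "X = {u. u < n \<and> majority n a v u \<noteq> q u}"
  have finX: "finite X" by (simp add: X_def)
  have err: "n \<le> 2 * conflicts n a p u + 2 * c" if "u \<in> X" for u
    using majority_error[of q v u n a] that unfolding cq c_def by (simp add: X_def q_def)
  have "real n * real c ^ 2 \<le> 0.021 * real n ^ 3"
    using v(2) k unfolding c_def by (metis of_nat_le_iff of_nat_mult of_nat_power order_trans)
  then have "real n * real c ^ 2 \<le> real n * (0.021 * real n ^ 2)"
    by (simp add: power3_eq_cube power2_eq_square)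
  then have "real c ^ 2 \<le> 0.021 * real n ^ 2"
    using \<open>n > 0\<close> by simp
  \<comment> \<open>The square of 0.145 is 0.021025, just above 0.021.\<close>
  also have "\<dots> \<le> (0.145 * real n) ^ 2"
    by (simp add: power_mult_distrib) (simp add: power2_eq_square)
  finally have c: "real c \<le> 0.145 * real n"
    by (rule power2_le_imp_le) simp
  have half: "(real n) ^ 2 / 8 \<le> real (conflicts n a p u) ^ 2" if "u \<in> X" for u
  proof -
    have "real n \<le> 2 * real (conflicts n a p u) + 2 * real c"
      using err[OF that] by linarith
    \<comment> \<open>Here 0.355 = 1/2 - 0.145, and its square 0.126025 exceeds 1/8. This is the
      origin of the factor 8 in \<open>8 * k\<close>.\<close>
    then have "0.355 * real n \<le> real (conflicts n a p u)"
      using c by simp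
    then have "(0.355 * real n) ^ 2 \<le> real (conflicts n a p u) ^ 2"
      by (intro power_mono) auto
    moreover have "(real n) ^ 2 / 8 \<le> (0.355 * real n) ^ 2"
      by (simp add: power_mult_distrib) (simp add: power2_eq_square)
    ultimately show ?thesis by linarith
  qed
  have "real (card X) * (real n ^ 2 / 8) = (\<Sum>u\<in>X. real n ^ 2 / 8)" by simp
  also have "\<dots> \<le> (\<Sum>u\<in>X. real (conflicts n a p u) ^ 2)"
    by (intro sum_mono half)
  also have "\<dots> \<le> (\<Sum>u<n. real (conflicts n a p u) ^ 2)"
    by (intro sum_mono2) (auto simp: X_def)
  also have "\<dots> = real (\<Sum>u<n. (conflicts n a p u)\<^sup>2)" by simp
  also have "\<dots> \<le> real k" using sum of_nat_le_iff by blast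
  finally have "real (card X * (n * n)) \<le> real (8 * k)"
    by (simp add: power2_eq_square)
  then have "light n (8 * k) X"
    unfolding light_def X_def of_nat_le_iff by auto
  moreover have "good n a k (flip (majority n a v) X) = good n a k q"
  proof -
    have *: "flip (majority n a v) X u = q u" if "u < n" for u
      using that by (auto simp: flip_def X_def)
    have "conflicts n a (flip (majority n a v) X) u = conflicts n a q u" if "u < n" for u
      using * that by (rule conflicts_cong)
    then show ?thesis unfolding good_def using * by auto
  qed
  moreover have "good n a k q" unfolding q_def good_iff by fact
  ultimately show ?thesis using v(1) by blast
qed

section \<open>Reduction of the clustering problem to good partitions\<close>

definition similar :: "nat set set \<Rightarrow> nat \<Rightarrow> nat \<Rightarrow> bool" where
  "similar E u w \<longleftrightarrow> u = w \<or> {u, w} \<in> E"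

lemma conflict_number_eq:
  assumes "two_partition {0..<n} V1 V2" "u < n"
  shows "conflict_number {0..<n} E V1 V2 u = conflicts n (similar E) (\<lambda>u. u \<in> V1) u"
proof -
  have *: "x < n \<Longrightarrow> x \<in> V2 \<longleftrightarrow> x \<notin> V1" for x
    using assms(1) unfolding two_partition_def by auto
  have "{w \<in> {0..<n}. in_conflict E V1 V2 w u} =
      {w. w < n \<and> ((u \<in> V1) = (w \<in> V1)) \<noteq> similar E u w}"
    using * assms(2) unfolding in_conflict_def similar_def by (auto simp: insert_commute)
  then show ?thesis by (simp only: conflict_number_def conflicts_def)
qed

lemma h2_eq:
  assumes "two_partition {0..<n} V1 V2"
  shows "h2 {0..<n} E V1 V2 = (\<Sum>u<n. (conflicts n (similar E) (\<lambda>u. u \<in> V1) u)\<^sup>2)"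
  unfolding h2_def lessThan_atLeast0
  by (rule sum.cong) (simp_all add: conflict_number_eq[OF assms])

lemma min_square_iff_good:
  "min_square_2_clustering {0..<n} E k \<longleftrightarrow> (\<exists>p. good n (similar E) k p)"
proof
  assume "min_square_2_clustering {0..<n} E k"
  then obtain V1 V2 where V: "two_partition {0..<n} V1 V2" "V1 \<noteq> {}" "V2 \<noteq> {}"
    "h2 {0..<n} E V1 V2 \<le> k"
    unfolding min_square_2_clustering_def by blast
  have "good n (similar E) k (\<lambda>u. u \<in> V1)"
    unfolding good_def
  proof (intro conjI)
    show "(\<Sum>u<n. (conflicts n (similar E) (\<lambda>u. u \<in> V1) u)\<^sup>2) \<le> k"
      using V(4) h2_eq[OF V(1)] by simp
    have V12: "V1 \<inter> V2 = {}" "V1 \<union> V2 = {0..<n}"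
      using V(1) by (simp_all add: two_partition_def)
    obtain x y where "x \<in> V1" "y \<in> V2" using V(2,3) by blast
    moreover from this have "x < n" "y < n" "y \<notin> V1"
      using V12 by (metis UnCI atLeastLessThan_iff disjoint_iff)+
    ultimately show "\<exists>u<n. u \<in> V1" "\<exists>u<n. u \<notin> V1" by blast+
  qed
  then show "\<exists>p. good n (similar E) k p" by blast
next
  assume "\<exists>p. good n (similar E) k p"
  then obtain p where p: "good n (similar E) k p" by blast
  define V1 where "V1 = {u. u < n \<and> p u}"
  define V2 where "V2 = {u. u < n \<and> \<not> p u}"
  have tp: "two_partition {0..<n} V1 V2"
    unfolding two_partition_def V1_def V2_def by auto
  have "conflicts n (similar E) (\<lambda>u. u \<in> V1) u = conflicts n (similar E) p u" if "u < n" for u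
    using that by (intro conflicts_cong) (auto simp: V1_def)
  then have "h2 {0..<n} E V1 V2 \<le> k"
    using p by (simp add: h2_eq[OF tp] good_def)
  then show "min_square_2_clustering {0..<n} E k"
    unfolding min_square_2_clustering_def
  proof (intro exI conjI)
    show "two_partition {0..<n} V1 V2" by (rule tp)
    show "V1 \<noteq> {}" "V2 \<noteq> {}"
      using p unfolding good_def V1_def V2_def by blast+
  qed
qed

section \<open>Enumerating light sets in the order of binary counting\<close>

text \<open>This is the order of binary numbers, with \<open>j\<close> as the digit of weight 2^j:
  the highest differing digit decides.\<close>

definition before :: "nat set \<Rightarrow> nat set \<Rightarrow> bool" where
  "before Z S \<longleftrightarrow> (\<exists>j. j \<in> S \<and> j \<notin> Z \<and> (\<forall>l>j. l \<in> Z \<longleftrightarrow> l \<in> S))"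

text \<open>The invariant of the scan for the successor: changing only digits below \<open>i\<close>
  yields no later light set.\<close>

definition last_from :: "nat \<Rightarrow> nat \<Rightarrow> nat set \<Rightarrow> nat \<Rightarrow> bool" where
  "last_from n K S i \<longleftrightarrow>
     (\<forall>Z. light n K Z \<longrightarrow> (\<forall>l\<ge>i. l \<in> Z \<longleftrightarrow> l \<in> S) \<longrightarrow> before Z S \<or> Z = S)"

lemma last_from_0: "last_from n K S 0"
  by (auto simp: last_from_def)

lemma agree_from_Suc:
  assumes "\<forall>l\<ge>Suc i. l \<in> Z \<longleftrightarrow> l \<in> S" "i \<in> Z \<longleftrightarrow> i \<in> S"
  shows "\<forall>l\<ge>i. l \<in> Z \<longleftrightarrow> l \<in> S"
proof (intro allI impI)
  fix l assume "i \<le> l"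
  then show "l \<in> Z \<longleftrightarrow> l \<in> S" using assms by (cases "l = i") auto
qed

text \<open>A competitor without \<open>i\<close> is smaller at digit \<open>i\<close>; one with
  \<open>i\<close> is covered by the hypothesis.\<close>

lemma last_from_Suc_mem:
  assumes "last_from n K S i" "i \<in> S"
  shows "last_from n K S (Suc i)"
  unfolding last_from_def
proof (intro allI impI)
  fix Z assume Z: "light n K Z" "\<forall>l\<ge>Suc i. l \<in> Z \<longleftrightarrow> l \<in> S"
  show "before Z S \<or> Z = S"
  proof (cases "i \<in> Z")
    case True
    then show ?thesis
      using agree_from_Suc[OF Z(2)] assms Z(1) unfolding last_from_def by blast
  next
    case False
    then show ?thesis using assms(2) Z(2) unfolding before_def by (auto simp: Suc_le_eq)
  qed
qed

text \<open>A competitor containing \<open>i\<close> would contain \<open>i\<close> together with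
  all of \<open>S\<close> above \<open>i\<close>, which already exceeds the budget. Only
  \<open>S - {..<i}\<close> is counted, since the successor may drop everything below
  \<open>i\<close>.\<close>

lemma last_from_Suc_full:
  assumes "last_from n K S i" "i \<notin> S" "light n K S" "K < Suc (card (S - {..<i})) * (n * n)"
  shows "last_from n K S (Suc i)"
  unfolding last_from_def
proof (intro allI impI)
  fix Z assume Z: "light n K Z" "\<forall>l\<ge>Suc i. l \<in> Z \<longleftrightarrow> l \<in> S"
  have fin: "finite Z" "finite S"
    using Z(1) assms(3) by (simp_all add: finite_light)
  have "i \<notin> Z"
  proof
    assume "i \<in> Z"
    have "x \<in> Z" if "x \<in> S" "\<not> x < i" for x
    proof -
      have "Suc i \<le> x" using that assms(2) by (cases "x = i") auto
      then show ?thesis using Z(2) that by blast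
    qed
    with \<open>i \<in> Z\<close> have "insert i (S - {..<i}) \<subseteq> Z"
      by auto
    then have "card (insert i (S - {..<i})) \<le> card Z"
      using fin by (intro card_mono) auto
    then have "Suc (card (S - {..<i})) \<le> card Z"
      using fin assms(2) by simp
    then have "Suc (card (S - {..<i})) * (n * n) \<le> card Z * (n * n)"
      by (rule mult_le_mono1)
    then show False using assms(4) Z(1) unfolding light_def by linarith
  qed
  then show "before Z S \<or> Z = S"
    using agree_from_Suc[OF Z(2)] assms Z(1) unfolding last_from_def by blast
qed

lemma last_from_end:
  assumes "last_from n K S n" "light n K S" "light n K Z"
  shows "before Z S \<or> Z = S"
proof -
  have "\<forall>l\<ge>n. l \<in> Z \<longleftrightarrow> l \<in> S"
    using assms(2,3) unfolding light_def by (auto simp: subset_iff)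
  then show ?thesis using assms(1,3) unfolding last_from_def by blast
qed

text \<open>As in binary addition with carry, the candidate successor \<open>Y\<close> sets one free
  digit and clears all lower ones.\<close>

context
  fixes S Y :: "nat set" and i :: nat
  assumes Y: "Y = insert i (S - {..<i})" and i: "i \<notin> S"
begin

lemma before_successor: "before S Y"
  unfolding before_def Y using i by (intro exI[of _ i]) auto

lemma before_successor_mono:
  assumes "before Z S" shows "before Z Y"
proof -
  obtain j where j: "j \<in> S" "j \<notin> Z" "\<forall>l>j. l \<in> Z \<longleftrightarrow> l \<in> S"
    using assms unfolding before_def by blast
  then have "j \<noteq> i" using i by blast
  show ?thesis
  proof (cases "i < j")
    case True
    then show ?thesis using j unfolding before_def Y by (intro exI[of _ j]) auto
  next
    case False
    then show ?thesis
      using j i \<open>j \<noteq> i\<close> unfolding before_def Y by (intro exI[of _ i]) auto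
  qed
qed

text \<open>Nothing light lies strictly between \<open>S\<close> and \<open>Y\<close>: a set that
  first differs from \<open>Y\<close> at \<open>i\<close> agrees with \<open>S\<close> from
  \<open>i\<close> on, where \<open>last_from\<close> applies; a difference above \<open>i\<close>
  is already one from \<open>S\<close>.\<close>

lemma before_successorD:
  assumes "last_from n K S i" "before Z Y" "light n K Z"
  shows "before Z S \<or> Z = S"
proof -
  obtain j where j: "j \<in> Y" "j \<notin> Z" "\<forall>l>j. l \<in> Z \<longleftrightarrow> l \<in> Y"
    using assms(2) unfolding before_def by blast
  show ?thesis
  proof (cases "j = i")
    case True
    then have "\<forall>l\<ge>i. l \<in> Z \<longleftrightarrow> l \<in> S"
      using j i Y by (auto simp: le_less)
    then show ?thesis using assms(1,3) unfolding last_from_def by blast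
  next
    case False
    then show ?thesis using j unfolding before_def Y by (intro disjI1 exI[of _ j]) auto
  qed
qed

end

section \<open>The program\<close>

text \<open>Register layout: 0: \<open>n\<close>, 1: \<open>k\<close>, 2: zero, 3: one, 4: \<open>n\<^sup>2\<close>, 5: \<open>8 k\<close>, 6: \<open>n\<^sup>2 + n\<close>,
  7: \<open>v\<close>, 8: answer so far, 9: enumeration not exhausted, 10: unspent part of \<open>8 k\<close>,
  12: base address of a partition, 13: \<open>u\<close>, 14: sum of squares, 15: size of a cluster,
  16: position in the counter, 17: counter stepped, 20: conflicts of \<open>u\<close>, 21: \<open>w\<close>,
  18, 19 and 22-25: scratch. The current partition is stored at \<open>n\<^sup>2\<close>, the characteristic vector
  of the current set of flipped vertices at \<open>n\<^sup>2 + n\<close>.\<close>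

definition count_body :: prog where
  "count_body = block [
     Do (Add 22 12 21), Do (Load 22 22),
     Do (Mul 23 13 0), Do (Add 23 23 21), Do (Load 23 23),
     Do (Sub 24 25 22), Do (Sub 22 22 25), Do (Add 24 24 22),
     Do (Sub 22 24 23), Do (Sub 23 23 24), Do (Add 22 22 23),
     Do (Sub 22 3 22), Do (Add 20 20 22), Do (Add 21 21 3)]"

definition count :: prog where
  "count = block [Do (Const 20 0), Do (Const 21 0), Do (Add 25 12 13), Do (Load 25 25),
     WhileLess 21 0 count_body]"

definition vote_body :: prog where
  "vote_body = block [count, Do (Add 18 20 20), Do (Add 19 12 13), Do (Load 19 19),
     IfLess 18 0 Skip (Do (Sub 19 3 19)),
     Do (Add 18 4 13), Do (Store 18 19), Do (Add 18 6 13), Do (Store 18 2), Do (Add 13 13 3)]"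

text \<open>The base address \<open>v * n\<close> makes row \<open>v\<close> of the matrix itself
  the partition that \<open>count\<close> reads.\<close>

definition vote :: prog where
  "vote = block [Do (Mul 12 7 0), Do (Const 13 0), WhileLess 13 0 vote_body]"

definition score_body :: prog where
  "score_body = block [count, Do (Mul 18 20 20), Do (Add 14 14 18),
     Do (Add 18 12 13), Do (Load 18 18), Do (Add 15 15 18), Do (Add 13 13 3)]"

text \<open>Adding one to \<open>k\<close> turns \<open>\<le>\<close> into the strict test
  available; the size of one cluster, compared with 0 and \<open>n\<close>, excludes empty
  clusters.\<close>

definition score :: prog where
  "score = block [Do (Add 12 4 2), Do (Const 13 0), Do (Const 14 0), Do (Const 15 0),
     WhileLess 13 0 score_body, Do (Add 18 1 3),
     IfLess 14 18 (IfLess 2 15 (IfLess 15 0 (Do (Const 8 1)) Skip) Skip) Skip]"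

definition toggle :: prog where
  "toggle = block [Do (Add 18 4 16), Do (Load 19 18), Do (Sub 19 3 19), Do (Store 18 19)]"

text \<open>A set digit is cleared and its \<open>n * n\<close> refunded; a free digit is set if the
  budget allows and skipped otherwise. Running past the last digit means that there is no
  successor.\<close>

definition step_body :: prog where
  "step_body = IfLess 16 0
     (block [Do (Add 18 6 16), Do (Load 19 18),
        IfLess 2 19
          (block [Do (Store 18 2), toggle, Do (Add 10 10 4), Do (Add 16 16 3)])
          (IfLess 10 4
             (Do (Add 16 16 3))
             (block [Do (Store 18 3), toggle, Do (Sub 10 10 4), Do (Const 17 1)]))])
     (block [Do (Const 17 1), Do (Const 9 0)])"

definition step :: prog where
  "step = block [Do (Const 16 0), Do (Const 17 0), WhileLess 17 3 step_body]"

definition try_body :: prog where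
  "try_body = block [vote, Do (Add 10 5 2), Do (Const 9 1), WhileLess 2 9 (block [score, step]),
     Do (Add 7 7 3)]"

definition diagonal_body :: prog where
  "diagonal_body = block [Do (Mul 18 13 0), Do (Add 18 18 13), Do (Store 18 3), Do (Add 13 13 3)]"

definition solver :: prog where
  "solver = block [Do (Const 3 1), Do (Mul 4 0 0), Do (Const 18 8), Do (Mul 5 1 18),
     Do (Add 6 4 0), Do (Const 13 0), WhileLess 13 0 diagonal_body,
     Do (Const 7 0), Do (Const 8 0), WhileLess 7 0 try_body, Do (Add 0 8 2)]"

section \<open>Correctness and running time of the program\<close>

lemma wp_WhileLess_rule:
  fixes \<mu> :: "state \<Rightarrow> nat"
  assumes "I s"
    and "\<And>s. I s \<Longrightarrow> regs s a < regs s b \<Longrightarrow>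
      wp W p (\<lambda>t s'. t \<le> T \<and> I s' \<and> \<mu> s' < \<mu> s) s"
    and "\<And>t s'. t \<le> \<mu> s * (T + 1) + 1 \<Longrightarrow> I s' \<Longrightarrow> \<not> regs s' a < regs s' b \<Longrightarrow> Q t s'"
  shows "wp W (WhileLess a b p) Q s"
proof (rule wp_mono)
  show "wp W (WhileLess a b p)
    (\<lambda>t s'. t \<le> \<mu> s * (T + 1) + 1 \<and> I s' \<and> \<not> regs s' a < regs s' b) s"
    using assms(1,2) by (rule wp_WhileLess)
qed (elim conjE, rule assms(3))

section \<open>Matrices and bit vectors in memory\<close>

definition matrix_at :: "nat \<Rightarrow> (nat \<Rightarrow> nat \<Rightarrow> bool) \<Rightarrow> (nat \<Rightarrow> nat) \<Rightarrow> bool" where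
  "matrix_at n a m \<longleftrightarrow> (\<forall>u<n. \<forall>w<n. m (u * n + w) = of_bool (a u w))"

definition array_at :: "nat \<Rightarrow> nat \<Rightarrow> (nat \<Rightarrow> bool) \<Rightarrow> (nat \<Rightarrow> nat) \<Rightarrow> bool" where
  "array_at n c p m \<longleftrightarrow> (\<forall>u<n. m (c + u) = of_bool (p u))"

lemma index_less: "u < n \<Longrightarrow> w < n \<Longrightarrow> u * n + w < n * (n::nat)"
proof -
  assume "u < n" "w < n"
  then have "u * n + w < Suc u * n" by simp
  also have "\<dots> \<le> n * n" using \<open>u < n\<close> by (intro mult_le_mono1) simp
  finally show "u * n + w < n * n" .
qed

lemma matrix_at_upd: "n * n \<le> c \<Longrightarrow> matrix_at n a (m(c := x)) = matrix_at n a m"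
proof -
  assume "n * n \<le> c"
  then have "u * n + w \<noteq> c" if "u < n" "w < n" for u w
    using index_less[OF that] by linarith
  then show "matrix_at n a (m(c := x)) = matrix_at n a m" unfolding matrix_at_def by simp
qed

lemma array_at_upd_other:
  assumes "c < b \<or> b + n \<le> c"
  shows "array_at n b p (m(c := x)) = array_at n b p m"
proof -
  have "b + u \<noteq> c" if "u < n" for u using assms that by linarith
  then show ?thesis unfolding array_at_def by simp
qed

lemma array_at_upd:
  assumes "array_at n b p m" "x = of_bool y"
  shows "array_at n b (p(u := y)) (m(b + u := x))"
  using assms unfolding array_at_def by simp

lemma array_at_Suc: "array_at (Suc u) b p m \<longleftrightarrow> array_at u b p m \<and> m (b + u) = of_bool (p u)"
  unfolding array_at_def by (auto simp: less_Suc_eq)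

lemma array_at_row: "matrix_at n a m \<Longrightarrow> v < n \<Longrightarrow> array_at n (v * n) (a v) m"
  unfolding array_at_def matrix_at_def by simp

lemma matrix_at_set:
  assumes "matrix_at n a m" "u < n" "w < n"
  shows "matrix_at n (\<lambda>x y. a x y \<or> x = u \<and> y = w) (m(u * n + w := 1))"
proof -
  have "x * n + y = u * n + w \<longleftrightarrow> x = u \<and> y = w" if "y < n" for x y
  proof
    assume eq: "x * n + y = u * n + w"
    have "(x * n + y) div n = (u * n + w) div n" "(x * n + y) mod n = (u * n + w) mod n"
      unfolding eq by simp_all
    then show "x = u \<and> y = w" using that \<open>w < n\<close> by simp
  qed simp
  then show ?thesis using assms(1) unfolding matrix_at_def by simp
qed

text \<open>Up to lower-order terms the largest numbers are the sum of squares and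
  \<open>8 * k\<close>, both at most n^3; addresses stay below n^2 + 2n.\<close>

locale ram =
  fixes n k W :: nat
  assumes n: "n > 0" and W: "8 * (n + 1) ^ 3 \<le> W" and k: "8 * k \<le> n ^ 3"
begin

lemma W_bounds:
  "n * n * n + n * n + 2 * n + 8 \<le> W" "8 * k + 1 < W" "k + 1 < W" "n * n + 2 * n < W" "8 < W"
  "1 < W" "n * n < W" "n * n + n < W" "n + n < W" "n + 1 < W" "0 < W"
proof -
  define N2 N3 where "N2 = n * n" and "N3 = n * n * n"
  have "(n + 1) ^ 3 = N3 + 3 * N2 + 3 * n + 1"
    by (simp add: power3_eq_cube algebra_simps N2_def N3_def)
  then have "8 * N3 + 24 * N2 + 24 * n + 8 \<le> W" "8 * k \<le> N3" "0 < N2"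
    using W k n by (simp_all add: power3_eq_cube N2_def N3_def)
  then show "n * n * n + n * n + 2 * n + 8 \<le> W" "8 * k + 1 < W" "k + 1 < W"
      "n * n + 2 * n < W" "8 < W" "1 < W" "n * n < W" "n * n + n < W" "n + n < W" "n + 1 < W" "0 < W"
    using n unfolding N3_def[symmetric] unfolding N2_def[symmetric] by - linarith+
qed

section \<open>Counting conflicts, voting and scoring\<close>

definition ctx :: "state \<Rightarrow> bool" where
  "ctx s \<longleftrightarrow> regs s 0 = n \<and> regs s 1 = k \<and> regs s 2 = 0 \<and> regs s 3 = 1 \<and> regs s 4 = n * n \<and>
     regs s 5 = 8 * k \<and> regs s 6 = n * n + n"

text \<open>An iteration takes 15 steps and a test; the remaining 6 steps are absorbed by
  \<open>n > 0\<close>. Preserving the registers below 20 lets callers keep their loop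
  variables.\<close>

lemma wp_count:
  assumes "ctx s" "matrix_at n a (mem s)" "array_at n b p (mem s)"
    "regs s 12 = b" "b \<le> n * n" "regs s 13 = u" "u < n"
  shows "wp W count (\<lambda>t s'. t \<le> 22 * n \<and> mem s' = mem s \<and> (\<forall>r<20. regs s' r = regs s r) \<and>
    regs s' 20 = conflicts n a p u) s"
proof -
  define I where "I s' \<longleftrightarrow> mem s' = mem s \<and> (\<forall>r<20. regs s' r = regs s r) \<and> regs s' 21 \<le> n \<and>
    regs s' 20 = card {w. w < regs s' 21 \<and> (p u = p w) \<noteq> a u w} \<and> regs s' 25 = of_bool (p u)"
    for s' :: state
  have regs: "regs s 0 = n" "regs s 3 = 1"
    using assms(1) by (simp_all add: ctx_def)
  have bodyI: "wp W count_body (\<lambda>t s''. t \<le> 15 \<and> I s'' \<and> n - regs s'' 21 < n - regs s' 21) s'"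
    if "I s'" "regs s' 21 < regs s' 0" for s'
  proof -
    define w where "w = regs s' 21"
    have w: "w < n" using that regs by (simp add: I_def w_def)
    have s': "mem s' = mem s" "\<And>r. r < 20 \<Longrightarrow> regs s' r = regs s r" "regs s' 21 = w"
        "regs s' 20 = card {x. x < w \<and> (p u = p x) \<noteq> a u x}" "regs s' 25 = of_bool (p u)"
      using that by (simp_all add: I_def w_def)
    have w': "Suc w \<le> n" "Suc w < W" "n - Suc w < n - w"
      using w W_bounds(10) by linarith+
    have m: "mem s (b + w) = of_bool (p w)" "mem s (u * n + w) = of_bool (a u w)"
      using assms w by (simp_all add: array_at_def matrix_at_def)
    have bd: "b + w < W" "u * n + w < W" "u * n < W"
      using index_less[OF \<open>u < n\<close> w] w \<open>b \<le> n * n\<close> W_bounds by linarith+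
    have "card {x. x < w \<and> (p u = p x) \<noteq> a u x} \<le> card {..<w}"
      by (intro card_mono) auto
    then have c: "card {x. x < w \<and> (p u = p x) \<noteq> a u x} + 1 < W"
      using w W_bounds(10) by simp
    have "{x. x < Suc w \<and> (p u = p x) \<noteq> a u x} =
        (if (p u = p w) \<noteq> a u w then insert w else id) {x. x < w \<and> (p u = p x) \<noteq> a u x}"
      by (auto simp: less_Suc_eq)
    then have "card {x. x < Suc w \<and> (p u = p x) \<noteq> a u x} =
        card {x. x < w \<and> (p u = p x) \<noteq> a u x} + of_bool ((p u = p w) \<noteq> a u w)"
      by simp
    then show ?thesis
      unfolding count_body_def block.simps
      using s' m bd c w' regs assms(4,6)
      by (cases "p u"; cases "p w"; cases "a u w") (simp_all add: wp_simps I_def)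
  qed
  have finish: "mem s' = mem s \<and> (\<forall>r<20. regs s' r = regs s r) \<and> regs s' 20 = conflicts n a p u"
    if "I s'" "\<not> regs s' 21 < regs s' 0" for s'
  proof -
    have "regs s' 21 = n" using that regs by (simp add: I_def)
    then show ?thesis using that(1) by (simp add: I_def conflicts_def)
  qed
  have bu: "b + u < W" using assms(5,7) W_bounds by linarith
  have mu: "mem s (b + u) = of_bool (p u)" using assms(3,7) by (simp add: array_at_def)
  show ?thesis
    unfolding count_def block.simps
    apply (simp add: wp_simps bu assms(4,6) regs W_bounds)
    apply (rule wp_WhileLess_rule[where I = I and \<mu> = "\<lambda>s. n - regs s 21" and T = 15])
      apply (simp add: I_def mu)
     apply (erule (1) bodyI)
    subgoal premises prems for t s'
      using n finish[OF prems(2,3)] prems(1) by (simp add: wp_simps)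
    done
qed

lemma wp_vote:
  assumes "ctx s" "matrix_at n a (mem s)" "regs s 7 = v" "v < n"
  shows "wp W vote (\<lambda>t s'. t \<le> 40 * (n * n) \<and> (\<forall>r<12. regs s' r = regs s r) \<and>
    matrix_at n a (mem s') \<and> array_at n (n * n) (majority n a v) (mem s') \<and>
    array_at n (n * n + n) (\<lambda>_. False) (mem s')) s"
proof -
  define I where "I s' \<longleftrightarrow> (\<forall>r<12. regs s' r = regs s r) \<and> matrix_at n a (mem s') \<and>
    regs s' 12 = v * n \<and> regs s' 13 \<le> n \<and>
    array_at (regs s' 13) (n * n) (majority n a v) (mem s') \<and>
    array_at (regs s' 13) (n * n + n) (\<lambda>_. False) (mem s')" for s' :: state
  have regs: "regs s 0 = n" "regs s 2 = 0" "regs s 3 = 1" "regs s 4 = n * n" "regs s 6 = n * n + n"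
    using assms(1) by (simp_all add: ctx_def)
  have bodyI: "wp W vote_body (\<lambda>t s''. t \<le> 34 * n \<and> I s'' \<and> n - regs s'' 13 < n - regs s' 13) s'"
    if "I s'" "regs s' 13 < regs s' 0" for s'
  proof -
    define u where "u = regs s' 13"
    define c where "c = conflicts n a (a v) u"
    have s': "\<And>r. r < 12 \<Longrightarrow> regs s' r = regs s r" "matrix_at n a (mem s')" "regs s' 12 = v * n"
        "regs s' 13 = u" "array_at u (n * n) (majority n a v) (mem s')"
        "array_at u (n * n + n) (\<lambda>_. False) (mem s')"
      using that(1) by (simp_all add: I_def u_def)
    have u: "u < n" using that s'(1,4) regs by simp
    have u': "Suc u \<le> n" "Suc u < W" "n - Suc u < n - u" "n * n + u < W" "n * n + n + u < W"
      using u W_bounds by linarith+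
    have vu: "v * n + u < W" "v * n \<le> n * n"
      using index_less[OF \<open>v < n\<close> u] W_bounds by linarith+
    have c: "c + c < W"
      using conflicts_le[of n a "a v" u] W_bounds unfolding c_def by linarith
    have m: "mem s' (v * n + u) = of_bool (a v u)"
      using s'(2) u \<open>v < n\<close> by (simp add: matrix_at_def)
    have maj: "majority n a v u \<longleftrightarrow> (a v u \<noteq> (n \<le> c + c))"
      by (simp add: majority_def c_def mult_2)
    have rest: "t + 12 \<le> 34 * n" if "t \<le> 22 * n" for t using that n by simp
    show ?thesis
      unfolding vote_body_def block.simps wp_Seq
    proof (rule wp_mono[OF wp_count[of s' a "v * n" "a v" u]], goal_cases)
      case 1 show ?case using assms(1) s'(1) by (simp add: ctx_def)
    next
      case (8 t s1)
      then have s1: "t + 12 \<le> 34 * n" "mem s1 = mem s'" "\<And>r. r < 20 \<Longrightarrow> regs s1 r = regs s' r"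
          "regs s1 20 = c"
        using rest by (simp_all add: c_def)
      show ?case
        using s1 s' regs u u' vu(1) c m maj n
        by (cases "a v u"; cases "c + c < n")
          (simp_all add: wp_simps I_def matrix_at_upd array_at_upd_other array_at_Suc)
    qed (use s' u vu array_at_row[OF s'(2) \<open>v < n\<close>] in simp_all)
  qed
  have nn: "n * n < W" "v * n < W" "0 < n * n"
    using index_less[OF \<open>v < n\<close> n] W_bounds(7) n by (linarith, linarith, simp)
  have time: "(n - 0) * (34 * n + 1) + 1 + 3 \<le> 40 * (n * n)"
  proof -
    have "(n - 0) * (34 * n + 1) + 1 + 3 = 34 * (n * n) + n + 4" by (simp add: distrib_left)
    then show ?thesis using nn(3) le_square[of n] by linarith
  qed
  have finish: "(\<forall>r<12. regs s' r = regs s r) \<and>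
    matrix_at n a (mem s') \<and> array_at n (n * n) (majority n a v) (mem s') \<and>
    array_at n (n * n + n) (\<lambda>_. False) (mem s')" if "I s'" "\<not> regs s' 13 < regs s' 0" for s'
  proof -
    have "regs s' 13 = n" using that regs by (simp add: I_def)
    then show ?thesis using that(1) by (simp add: I_def)
  qed
  show ?thesis
    unfolding vote_def block.simps
    apply (simp add: wp_simps nn assms(3) regs W_bounds)
    apply (rule wp_WhileLess_rule[where I = I and \<mu> = "\<lambda>s. n - regs s 13" and T = "34 * n"])
      apply (use assms(2) in \<open>simp add: I_def array_at_def\<close>)
     apply (erule (1) bodyI)
    subgoal premises prems for t s'
      using time finish[OF prems(2,3)] prems(1) by (simp add: wp_simps)
    done
qed

lemma wp_score:
  assumes "ctx s" "matrix_at n a (mem s)" "array_at n (n * n) d (mem s)" "regs s 8 = of_bool A"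
  shows "wp W score (\<lambda>t s'. t \<le> 45 * (n * n) \<and> mem s' = mem s \<and>
    (\<forall>r<12. r \<noteq> 8 \<longrightarrow> regs s' r = regs s r) \<and> regs s' 8 = of_bool (A \<or> good n a k d)) s"
proof -
  define I where "I s' \<longleftrightarrow> (\<forall>r<12. regs s' r = regs s r) \<and> mem s' = mem s \<and>
    regs s' 12 = n * n \<and> regs s' 13 \<le> n \<and>
    regs s' 14 = (\<Sum>x<regs s' 13. (conflicts n a d x)\<^sup>2) \<and>
    regs s' 15 = (\<Sum>x<regs s' 13. of_bool (d x))" for s' :: state
  have regs: "regs s 0 = n" "regs s 1 = k" "regs s 2 = 0" "regs s 3 = 1" "regs s 4 = n * n"
    using assms(1) by (simp_all add: ctx_def)
  have bodyI: "wp W score_body (\<lambda>t s''. t \<le> 29 * n \<and> I s'' \<and> n - regs s'' 13 < n - regs s' 13) s'"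
    if "I s'" "regs s' 13 < regs s' 0" for s'
  proof -
    define u where "u = regs s' 13"
    define c where "c = conflicts n a d u"
    define tot where "tot = (\<Sum>x<u. (conflicts n a d x)\<^sup>2)"
    define ones :: nat where "ones = (\<Sum>x<u. of_bool (d x))"
    have s': "\<And>r. r < 12 \<Longrightarrow> regs s' r = regs s r" "mem s' = mem s" "regs s' 12 = n * n"
        "regs s' 13 = u" "regs s' 14 = tot" "regs s' 15 = ones"
      using that(1) by (simp_all add: I_def u_def tot_def ones_def)
    have u: "u < n" using that s'(1,4) regs by simp
    have u': "Suc u \<le> n" "Suc u < W" "n - Suc u < n - u" "n * n + u < W"
      using u W_bounds by linarith+
    have cn: "c \<le> n" unfolding c_def by (rule conflicts_le)
    have "ones \<le> (\<Sum>x<u. 1)" unfolding ones_def by (intro sum_mono) simp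
    then have ones: "Suc ones < W" using u W_bounds by simp
    \<comment> \<open>The running sum of squares must fit into a word; n^3 bounds it by the trivial
      bound \<open>n\<close> on each conflict number.\<close>
    have "tot \<le> (\<Sum>x<u. n\<^sup>2)"
      unfolding tot_def by (intro sum_mono power_mono conflicts_le) simp
    also have "\<dots> \<le> n * n * n"
      using u by (simp add: power2_eq_square mult_le_mono1)
    finally have "tot \<le> n * n * n" .
    moreover have cc: "c * c \<le> n * n" using cn by (intro mult_le_mono)
    ultimately have tot: "tot + c * c < W" "c * c < W"
      using W_bounds by linarith+
    have m: "mem s (n * n + u) = of_bool (d u)"
      using assms(3) u by (simp add: array_at_def)
    have rest: "t + 7 \<le> 29 * n" if "t \<le> 22 * n" for t using that n by simp
    have sums: "(\<Sum>x<Suc u. (conflicts n a d x)\<^sup>2) = tot + c * c"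
        "(\<Sum>x<Suc u. of_bool (d x)) = ones + of_bool (d u)"
      by (simp_all add: tot_def ones_def c_def power2_eq_square)
    show ?thesis
      unfolding score_body_def block.simps wp_Seq
    proof (rule wp_mono[OF wp_count[of s' a "n * n" d u]], goal_cases)
      case 1 show ?case using assms(1) s'(1) by (simp add: ctx_def)
    next
      case (8 t s1)
      then have s1: "t + 7 \<le> 29 * n" "mem s1 = mem s" "\<And>r. r < 20 \<Longrightarrow> regs s1 r = regs s' r"
          "regs s1 20 = c"
        using rest s'(2) by (simp_all add: c_def)
      show ?case
        using s1 s' regs u' tot ones m sums
        by (cases "d u") (simp_all add: wp_simps I_def del: sum.lessThan_Suc)
    qed (use s' u assms(2,3) in simp_all)
  qed
  have nn: "n * n < W" "0 < n * n" using W_bounds n by auto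
  have time: "(n - 0) * (29 * n + 1) + 1 + 11 \<le> 45 * (n * n)"
  proof -
    have "(n - 0) * (29 * n + 1) + 1 + 11 = 29 * (n * n) + n + 12" by (simp add: distrib_left)
    then show ?thesis using nn(2) le_square[of n] by linarith
  qed
  have "(0 < (\<Sum>x<j. of_bool (d x) :: nat) \<longleftrightarrow> (\<exists>x<j. d x)) \<and>
      (\<Sum>x<j. of_bool (d x) :: nat) \<le> j \<and>
      ((\<Sum>x<j. of_bool (d x) :: nat) < j \<longleftrightarrow> (\<exists>x<j. \<not> d x))" for j
  proof (induction j)
    case (Suc j)
    then show ?case by (cases "d j") (simp_all add: Ex_less_Suc)
  qed simp
  then have pos: "0 < (\<Sum>x<n. of_bool (d x) :: nat) \<longleftrightarrow> (\<exists>x<n. d x)"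
    and less: "(\<Sum>x<n. of_bool (d x) :: nat) < n \<longleftrightarrow> (\<exists>x<n. \<not> d x)"
    by (blast, blast)
  have finish: "regs s' 0 = n \<and> regs s' 1 = k \<and> regs s' 2 = 0 \<and> regs s' 3 = 1 \<and> mem s' = mem s \<and>
      (\<forall>r<12. regs s' r = regs s r) \<and>
      (good n a k d \<longleftrightarrow> regs s' 14 < Suc k \<and> 0 < regs s' 15 \<and> regs s' 15 < n)"
    if "I s'" "\<not> regs s' 13 < regs s' 0" for s'
  proof -
    have "regs s' 13 = n" using that regs by (simp add: I_def)
    then show ?thesis
      using that(1) pos less regs by (simp add: I_def good_def less_Suc_eq_le)
  qed
  define ans :: nat where "ans = of_bool (A \<or> good n a k d)"
  have ans: "ans = (if good n a k d then 1 else regs s 8)"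
    using assms(4) by (simp add: ans_def)
  show ?thesis
    unfolding score_def block.simps ans_def[symmetric]
    apply (simp add: wp_simps nn regs W_bounds)
    apply (rule wp_WhileLess_rule[where I = I and \<mu> = "\<lambda>s. n - regs s 13" and T = "29 * n"])
      apply (simp add: I_def)
     apply (erule (1) bodyI)
    subgoal premises prems for t s'
      using finish[OF prems(2,3)] prems(1) time ans W_bounds(3,6) by (simp add: wp_simps)
    done
qed

section \<open>One step of the counter\<close>

definition represents :: "(nat \<Rightarrow> nat \<Rightarrow> bool) \<Rightarrow> (nat \<Rightarrow> bool) \<Rightarrow> nat set \<Rightarrow> state \<Rightarrow> bool" where
  "represents a q S s \<longleftrightarrow> matrix_at n a (mem s) \<and> array_at n (n * n) (flip q S) (mem s) \<and>
     array_at n (n * n + n) (\<lambda>u. u \<in> S) (mem s) \<and> light n (8 * k) S \<and>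
     regs s 10 = 8 * k - card S * (n * n)"

text \<open>Setting and clearing a digit both negate one cell in each of the two vectors, so one
  lemma serves both.\<close>

lemma represents_change:
  assumes "represents a q S s" "i < n"
    and S': "\<And>j. j \<noteq> i \<Longrightarrow> j \<in> S' \<longleftrightarrow> j \<in> S" "i \<in> S' \<longleftrightarrow> i \<notin> S" "light n (8 * k) S'"
    and s': "mem s' = (mem s)(n * n + n + i := of_bool (i \<notin> S), n * n + i := 1 - mem s (n * n + i))"
      "regs s' 10 = 8 * k - card S' * (n * n)"
  shows "represents a q S' s'"
proof -
  have fl: "flip q S' = (flip q S)(i := \<not> flip q S i)" "(\<lambda>u. u \<in> S') = (\<lambda>u. u \<in> S)(i := i \<notin> S)"
    by (rule flip_change; use S'(1,2) in blast)+
  have "1 - mem s (n * n + i) = of_bool (\<not> flip q S i)"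
    using assms(1,2) by (simp add: represents_def array_at_def)
  moreover have "array_at n (n * n) (flip q S) ((mem s)(n * n + n + i := of_bool (i \<notin> S)))"
    using assms(1) by (simp add: represents_def array_at_upd_other)
  ultimately have "array_at n (n * n) (flip q S') (mem s')"
    unfolding s'(1) fl(1) by (intro array_at_upd)
  moreover have "array_at n (n * n + n) (\<lambda>u. u \<in> S') (mem s')"
    unfolding s'(1) fl(2)
    using assms(1,2)
    by (subst array_at_upd_other) (auto simp: represents_def intro!: array_at_upd)
  moreover have "matrix_at n a (mem s')"
    unfolding s'(1) using assms(1) by (simp add: represents_def matrix_at_upd)
  ultimately show ?thesis using S'(3) s'(2) by (simp add: represents_def)
qed

text \<open>The second alternative makes \<open>Y\<close> the immediate successor of
  \<open>S\<close> among the light sets, split into the inclusions that update the answer and the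
  measure.\<close>

definition stepped :: "(nat \<Rightarrow> nat \<Rightarrow> bool) \<Rightarrow> (nat \<Rightarrow> bool) \<Rightarrow> nat set \<Rightarrow> state \<Rightarrow> bool" where
  "stepped a q S s \<longleftrightarrow> matrix_at n a (mem s) \<and>
     (regs s 9 = 0 \<and> (\<forall>Z. light n (8 * k) Z \<longrightarrow> before Z S \<or> Z = S) \<or>
      regs s 9 = 1 \<and> (\<exists>Y. represents a q Y s \<and> before S Y \<and>
        (\<forall>Z. before Z S \<longrightarrow> before Z Y) \<and>
        (\<forall>Z. light n (8 * k) Z \<longrightarrow> before Z Y \<longrightarrow> before Z S \<or> Z = S)))"

lemma wp_step:
  assumes "ctx s" "represents a q S s" "regs s 9 = 1"
  shows "wp W step (\<lambda>t s'. t \<le> 45 * n \<and> (\<forall>r<9. regs s' r = regs s r) \<and> stepped a q S s') s"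
proof -
  \<comment> \<open>During the scan the memory represents \<open>S\<close> with all digits below the
    position cleared, while \<open>S\<close> itself survives only as a logical value.\<close>
  define I where "I s' \<longleftrightarrow> (\<forall>r<9. regs s' r = regs s r) \<and> regs s' 16 \<le> n \<and>
    (regs s' 17 = 0 \<and> regs s' 9 = 1 \<and> last_from n (8 * k) S (regs s' 16) \<and>
       represents a q (S - {..<regs s' 16}) s' \<or>
     regs s' 17 = 1 \<and> stepped a q S s')" for s' :: state
  have regs: "regs s 0 = n" "regs s 2 = 0" "regs s 3 = 1" "regs s 4 = n * n" "regs s 6 = n * n + n"
    using assms(1) by (simp_all add: ctx_def)
  have light: "light n (8 * k) S" using assms(2) by (simp add: represents_def)
  have fin: "finite S" using light by (rule finite_light)
  \<comment> \<open>The second summand pays for the final iteration, which raises the flag but does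
    not advance the position.\<close>
  define \<mu> where "\<mu> s' = (n - regs s' 16) + (1 - regs s' 17)" for s' :: state
  have bodyI: "wp W step_body (\<lambda>t s''. t \<le> 17 \<and> I s'' \<and> \<mu> s'' < \<mu> s') s'"
    if "I s'" "regs s' 17 < regs s' 3" for s'
  proof -
    define i where "i = regs s' 16"
    define R where "R = 8 * k - card (S - {..<i}) * (n * n)"
    have s': "\<And>r. r < 9 \<Longrightarrow> regs s' r = regs s r" "regs s' 16 = i" "regs s' 17 = 0" "regs s' 9 = 1"
        "i \<le> n" and lst: "last_from n (8 * k) S i" and rep: "represents a q (S - {..<i}) s'"
      using that regs by (auto simp: I_def i_def)
    have R: "regs s' 10 = R" using rep by (simp add: represents_def R_def)
    have li: "light n (8 * k) (S - {..<i})" using rep by (simp add: represents_def)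
    then have cR: "card (S - {..<i}) * (n * n) + R = 8 * k" by (simp add: R_def light_def)
    show ?thesis
    proof (cases "i < n")
      case False
      then have "i = n" using s' by simp
      define s1 where "s1 = s'\<lparr>regs := (regs s')(17 := 1, 9 := 0)\<rparr>"
      have "stepped a q S s1"
        using last_from_end[OF _ light] lst rep \<open>i = n\<close>
        by (auto simp: stepped_def represents_def s1_def)
      then have "I s1" using s' by (simp add: I_def s1_def)
      then show ?thesis
        unfolding step_body_def block.simps s1_def
        using s' False regs W_bounds(6,11) by (simp add: wp_simps \<mu>_def)
    next
      case True
      have b: "n * n + n + i < W" "n * n + i < W" "Suc i < W" "0 < n" "n - Suc i < n - i"
        using True W_bounds n by linarith+
      have x: "mem s' (n * n + n + i) = of_bool (i \<in> S)"
        using rep True by (simp add: represents_def array_at_def)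
      show ?thesis
      proof (cases "i \<in> S")
        case iS: True
        have eq: "S - {..<i} = insert i (S - {..<Suc i})" using iS by auto
        have card: "card (S - {..<i}) = Suc (card (S - {..<Suc i}))"
          unfolding eq using fin by (subst card_insert_disjoint) auto
        have R': "R + n * n = 8 * k - card (S - {..<Suc i}) * (n * n)"
          using cR unfolding card by simp
        have RW: "R + n * n < W" using R' W_bounds(2) by linarith
        define s1 where "s1 = s'\<lparr>mem := (mem s')(n * n + n + i := 0, n * n + i := 1 - mem s' (n * n + i)),
            regs := (regs s')(18 := n * n + i, 19 := 1 - mem s' (n * n + i),
            10 := R + n * n, 16 := Suc i)\<rparr>"
        have "light n (8 * k) (S - {..<Suc i})"
          using li by (rule light_mono) auto
        then have "represents a q (S - {..<Suc i}) s1"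
          using iS R' by (intro represents_change[OF rep True]) (auto simp: s1_def)
        moreover have "last_from n (8 * k) S (Suc i)" using lst iS by (rule last_from_Suc_mem)
        ultimately have "I s1" using s' True by (simp add: I_def s1_def)
        then show ?thesis
          unfolding step_body_def toggle_def block.simps s1_def
          using s' x iS True regs b R RW by (simp add: wp_simps \<mu>_def)
      next
        case iS: False
        have eq: "S - {..<Suc i} = S - {..<i}" using iS by (auto simp: less_Suc_eq)
        show ?thesis
        proof (cases "R < n * n")
          case less: True
          define s1 where "s1 = s'\<lparr>regs := (regs s')(18 := n * n + n + i, 19 := 0, 16 := Suc i)\<rparr>"
          have "last_from n (8 * k) S (Suc i)"
            using lst iS light by (rule last_from_Suc_full) (use less cR in simp)
          moreover have "represents a q (S - {..<Suc i}) s1"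
            using rep unfolding eq by (simp add: represents_def s1_def)
          ultimately have "I s1" using s' True by (simp add: I_def s1_def)
          then show ?thesis
            unfolding step_body_def toggle_def block.simps s1_def
            using s' x iS True regs b R less by (simp add: wp_simps \<mu>_def)
        next
          case ge: False
          define Y where "Y = insert i (S - {..<i})"
          have cardY: "card Y = Suc (card (S - {..<i}))"
            unfolding Y_def using fin iS by simp
          have R': "R - n * n = 8 * k - card Y * (n * n)"
            unfolding cardY R_def by simp
          define s1 where "s1 = s'\<lparr>mem := (mem s')(n * n + n + i := 1, n * n + i := 1 - mem s' (n * n + i)),
            regs := (regs s')(18 := n * n + i, 19 := 1 - mem s' (n * n + i),
              10 := R - n * n, 17 := 1)\<rparr>"
          have "card Y * (n * n) \<le> 8 * k" using ge cR unfolding cardY by simp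
          moreover have "Y \<subseteq> {..<n}" using True light unfolding Y_def light_def by auto
          ultimately have "light n (8 * k) Y" unfolding light_def by simp
          then have "represents a q Y s1"
            using iS R' by (intro represents_change[OF rep True]) (auto simp: s1_def Y_def)
          moreover have "before S Y" using Y_def iS by (rule before_successor)
          moreover have "before Z Y" if "before Z S" for Z
            using Y_def iS that by (rule before_successor_mono)
          moreover have "before Z S \<or> Z = S" if "before Z Y" "light n (8 * k) Z" for Z
            using Y_def iS lst that by (rule before_successorD)
          moreover have "matrix_at n a (mem s1)"
            using \<open>represents a q Y s1\<close> by (simp add: represents_def)
          moreover have "regs s1 9 = 1" using s' by (simp add: s1_def)
          ultimately have "stepped a q S s1" unfolding stepped_def by blast
          then have "I s1" using s' by (simp add: I_def s1_def)
          then show ?thesis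
            unfolding step_body_def toggle_def block.simps s1_def
            using s' x iS True regs b R ge W_bounds(6) by (simp add: wp_simps \<mu>_def)
        qed
      qed
    qed
  qed
  have finish: "(\<forall>r<9. regs s' r = regs s r) \<and> stepped a q S s'"
    if "I s'" "\<not> regs s' 17 < regs s' 3" for s'
    using that regs by (auto simp: I_def)
  have rep0: "represents a q S (s\<lparr>regs := (regs s)(16 := 0, 17 := 0)\<rparr>)"
    using assms(2) by (simp add: represents_def)
  show ?thesis
    unfolding step_def block.simps
    apply (simp add: wp_simps W_bounds)
    apply (rule wp_WhileLess_rule[where I = I and \<mu> = \<mu> and T = 17])
      apply (use rep0 assms(3) in \<open>simp add: I_def last_from_0\<close>)
     apply (erule (1) bodyI)
    subgoal premises prems for t s'
      using finish[OF prems(2,3)] prems(1) n by (simp add: wp_simps \<mu>_def)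
    done
qed

section \<open>Exhausting all light sets\<close>

lemma wp_enumerate:
  assumes "ctx s" "represents a q {} s" "regs s 8 = of_bool A" "regs s 9 = 1"
  shows "wp W (WhileLess 2 9 (block [score, step]))
    (\<lambda>t s'. t \<le> card (light_sets n (8 * k)) * (91 * (n * n) + 1) + 1 \<and>
      (\<forall>r<8. regs s' r = regs s r) \<and> matrix_at n a (mem s') \<and>
      regs s' 8 = of_bool (A \<or> (\<exists>Z. light n (8 * k) Z \<and> good n a k (flip q Z)))) s"
proof -
  let ?K = "8 * k"
  define found where "found S \<longleftrightarrow> A \<or> (\<exists>Z. light n ?K Z \<and> before Z S \<and> good n a k (flip q Z))" for S
  define all where "all \<longleftrightarrow> A \<or> (\<exists>Z. light n ?K Z \<and> good n a k (flip q Z))"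
  \<comment> \<open>The loop rule wants a measure on states, so the current set is read back from
    memory. The measure counts the light sets not yet passed, the current one included.\<close>
  define current where "current s' = {u. u < n \<and> mem s' (n * n + n + u) = 1}" for s' :: state
  define \<mu> where "\<mu> s' = (if regs s' 9 = 0 then 0
    else card {Z \<in> light_sets n ?K. \<not> before Z (current s')})" for s' :: state
  define I where "I s' \<longleftrightarrow> (\<forall>r<8. regs s' r = regs s r) \<and> matrix_at n a (mem s') \<and>
    (regs s' 9 = 0 \<and> regs s' 8 = of_bool all \<or>
     regs s' 9 = 1 \<and> (\<exists>S. represents a q S s' \<and> regs s' 8 = of_bool (found S)))" for s' :: state
  have current: "current s' = S" if "represents a q S s'" for S s'
    using that by (auto simp: represents_def array_at_def light_def current_def simp del: One_nat_def)
  have irrefl: "\<not> before S S" for S by (simp add: before_def)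
  have bodyI: "wp W (block [score, step]) (\<lambda>t s''. t \<le> 91 * (n * n) \<and> I s'' \<and> \<mu> s'' < \<mu> s') s'"
    if I: "I s'" and loop: "regs s' 2 < regs s' 9" for s'
  proof -
    obtain S where S: "represents a q S s'" "regs s' 8 = of_bool (found S)" "regs s' 9 = 1"
      using I loop by (auto simp: I_def)
    have frame: "\<forall>r<8. regs s' r = regs s r" using I by (simp add: I_def)
    have ctx: "ctx s'" using frame assms(1) by (simp add: ctx_def)
    have light: "light n ?K S" using S(1) by (simp add: represents_def)
    have mu: "\<mu> s' = card {Z \<in> light_sets n ?K. \<not> before Z S}"
      using S current[OF S(1)] by (simp add: \<mu>_def)
    have fin: "finite {Z \<in> light_sets n ?K. \<not> before Z S}"
      using finite_light_sets by simp
    show ?thesis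
      unfolding block.simps wp_Seq
    proof (rule wp_mono[OF wp_score[of s' a "flip q S" "found S"]], goal_cases)
      case (5 t1 s1)
      then have s1: "t1 \<le> 45 * (n * n)" "mem s1 = mem s'"
          "\<And>r. r < 12 \<Longrightarrow> r \<noteq> 8 \<Longrightarrow> regs s1 r = regs s' r"
          "regs s1 8 = of_bool (found S \<or> good n a k (flip q S))"
        by simp_all
      show ?case
      proof (rule wp_mono[OF wp_step[of s1 a q S]], goal_cases)
        case 1 show ?case using ctx s1(3) by (simp add: ctx_def)
      next
        case 2 show ?case using S(1) s1(2,3) by (simp add: represents_def)
      next
        case 3 show ?case using S(3) s1(3) by simp
      next
        case (4 t2 s2)
        then have s2: "t2 \<le> 45 * n" "\<And>r. r < 9 \<Longrightarrow> regs s2 r = regs s1 r" "stepped a q S s2"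
          by simp_all
        have frame2: "\<forall>r<8. regs s2 r = regs s r"
          using s2(2) s1(3) frame by simp
        have ans: "regs s2 8 = of_bool (found S \<or> good n a k (flip q S))"
          using s2(2) s1(4) by simp
        have mat: "matrix_at n a (mem s2)" using s2(3) by (simp add: stepped_def)
        have "I s2 \<and> \<mu> s2 < \<mu> s'"
        proof (cases "regs s2 9 = 0")
          case True
          then have last: "before Z S \<or> Z = S" if "light n ?K Z" for Z
            using s2(3) that by (auto simp: stepped_def)
          \<comment> \<open>The light sets before \<open>Y\<close> are those before \<open>S\<close>
            and \<open>S\<close> itself, which has just been scored.\<close>
          have "found S \<or> good n a k (flip q S) \<longleftrightarrow> all"
            using last light unfolding found_def all_def by blast
          then have "I s2" using True frame2 mat ans by (simp add: I_def)
          moreover have "S \<in> {Z \<in> light_sets n ?K. \<not> before Z S}"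
            using light irrefl by (simp add: light_sets_def)
          then have "0 < \<mu> s'" unfolding mu using fin card_gt_0_iff by blast
          ultimately show ?thesis using True by (simp add: \<mu>_def)
        next
          case False
          then obtain Y where Y: "regs s2 9 = 1" "represents a q Y s2" "before S Y"
              "\<And>Z. before Z S \<Longrightarrow> before Z Y"
              "\<And>Z. light n ?K Z \<Longrightarrow> before Z Y \<Longrightarrow> before Z S \<or> Z = S"
            using s2(3) by (auto simp: stepped_def)
          have "found S \<or> good n a k (flip q S) \<longleftrightarrow> found Y"
            using Y(3-5) light unfolding found_def by blast
          then have "I s2" using Y(1,2) frame2 mat ans by (auto simp: I_def)
          moreover have "{Z \<in> light_sets n ?K. \<not> before Z Y} \<subset> {Z \<in> light_sets n ?K. \<not> before Z S}"
            using Y(3,4) light irrefl by (auto simp: light_sets_def)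
          then have "card {Z \<in> light_sets n ?K. \<not> before Z Y} < \<mu> s'"
            unfolding mu by (rule psubset_card_mono[OF fin])
          then have "\<mu> s2 < \<mu> s'" using Y(1) current[OF Y(2)] by (simp add: \<mu>_def)
          ultimately show ?thesis by blast
        qed
        moreover have "t1 + (t2 + 1) \<le> 91 * (n * n)"
        proof -
          have "0 < n * n" using n by simp
          then show ?thesis using s1(1) s2(1) le_square[of n] by linarith
        qed
        ultimately show ?case by (simp add: wp_simps)
      qed
    next
      case 4 show ?case using S by simp
    qed (use ctx S in \<open>simp_all add: represents_def\<close>)
  qed
  have "\<not> found {} \<or> A" by (auto simp: found_def before_def)
  then have found0: "found {} \<longleftrightarrow> A" by (auto simp: found_def)
  have "\<mu> s \<le> card (light_sets n ?K)"
    using finite_light_sets by (auto simp: \<mu>_def intro!: card_mono)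
  then have time: "\<mu> s * (91 * (n * n) + 1) + 1 \<le> card (light_sets n ?K) * (91 * (n * n) + 1) + 1"
    by (intro add_mono mult_le_mono1) simp_all
  show ?thesis
    unfolding all_def[symmetric]
  proof (rule wp_WhileLess_rule[where I = I and \<mu> = \<mu> and T = "91 * (n * n)"])
    show "I s"
      using assms found0 by (auto simp: I_def represents_def intro!: exI[of _ "{}"])
  next
    fix t s'
    assume "t \<le> \<mu> s * (91 * (n * n) + 1) + 1" "I s'" "\<not> regs s' 2 < regs s' 9"
    moreover from this have "regs s' 9 = 0" using assms(1) by (auto simp: I_def ctx_def)
    ultimately show "t \<le> card (light_sets n ?K) * (91 * (n * n) + 1) + 1 \<and>
      (\<forall>r<8. regs s' r = regs s r) \<and> matrix_at n a (mem s') \<and> regs s' 8 = of_bool all"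
      using time by (simp add: I_def)
  qed (rule bodyI)
qed

lemma wp_try_body:
  assumes "ctx s" "matrix_at n a (mem s)" "regs s 7 = v" "v < n" "regs s 8 = of_bool A"
  shows "wp W try_body (\<lambda>t s'. t \<le> 140 * (card (light_sets n (8 * k)) * (n * n)) \<and> ctx s' \<and>
    matrix_at n a (mem s') \<and> regs s' 7 = Suc v \<and>
    regs s' 8 = of_bool (A \<or> (\<exists>Z. light n (8 * k) Z \<and> good n a k (flip (majority n a v) Z)))) s"
proof -
  define B where "B = card (light_sets n (8 * k))"
  define res :: nat where
    "res = of_bool (A \<or> (\<exists>Z. light n (8 * k) Z \<and> good n a k (flip (majority n a v) Z)))"
  have bounds: "Suc v < W" using assms(4) W_bounds(10) by simp
  have time: "t + t' + 5 \<le> 140 * (B * (n * n))"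
    if "t \<le> 40 * (n * n)" "t' \<le> B * (91 * (n * n) + 1) + 1" for t t'
  proof -
    have "1 * 1 \<le> B * (n * n)" "B * 1 \<le> B * (n * n)" "1 * (n * n) \<le> B * (n * n)"
      using card_light_sets_pos[of n "8 * k"] n unfolding B_def[symmetric]
      by (intro mult_le_mono; simp)+
    moreover have "B * (91 * (n * n) + 1) + 1 = 91 * (B * (n * n)) + B + 1"
      by (simp add: distrib_left)
    ultimately show ?thesis using that by linarith
  qed
  show ?thesis
    unfolding try_body_def block.simps(1) block.simps(2)[of vote] block.simps(2)[of "Do _"]
      block.simps(2)[of "WhileLess _ _ _"] wp_Seq B_def[symmetric] res_def[symmetric]
  proof (rule wp_mono[OF wp_vote[OF assms(1-4)]], goal_cases)
    case (1 t s1)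
    then have s1: "t \<le> 40 * (n * n)" "\<And>r. r < 12 \<Longrightarrow> regs s1 r = regs s r"
        "matrix_at n a (mem s1)" "array_at n (n * n) (majority n a v) (mem s1)"
        "array_at n (n * n + n) (\<lambda>_. False) (mem s1)"
      by simp_all
    define s2 where "s2 = s1\<lparr>regs := (regs s1)(10 := 8 * k, 9 := 1)\<rparr>"
    have regs: "regs s1 5 = 8 * k" "regs s1 2 = 0"
      using s1(2) assms(1) by (simp_all add: ctx_def)
    have ctx2: "ctx s2" using s1(2) assms(1) by (simp add: ctx_def s2_def)
    have rep: "represents a (majority n a v) {} s2"
      using s1(3-5) by (simp add: represents_def s2_def light_def flip_empty)
    have "wp W (WhileLess 2 9 (block [score, step])) (\<lambda>t'. wp W (Do (Add 7 7 3)) (\<lambda>t''. wp W Skip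
        (\<lambda>t''' s'. Suc (Suc (t + (t' + (t'' + t''')))) \<le> 140 * (B * (n * n)) \<and> ctx s' \<and>
          matrix_at n a (mem s') \<and> regs s' 7 = Suc v \<and> regs s' 8 = res))) s2"
    proof (rule wp_mono[OF wp_enumerate[OF ctx2 rep, of A]], goal_cases)
      case 1 show ?case using s1(2) assms(5) by (simp add: s2_def)
    next
      case 2 show ?case by (simp add: s2_def)
    next
      case (3 t' s')
      then have s': "t' \<le> B * (91 * (n * n) + 1) + 1" "\<And>r. r < 8 \<Longrightarrow> regs s' r = regs s2 r"
          "matrix_at n a (mem s')" "regs s' 8 = res"
        by (simp_all add: B_def res_def)
      have "regs s' 7 = v" "regs s' 3 = 1"
        using s'(2) s1(2) assms(1,3) by (simp_all add: s2_def ctx_def)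
      moreover have "ctx s'" using s'(2) ctx2 by (simp add: ctx_def)
      ultimately show ?case
        using s'(3,4) time[OF s1(1) s'(1)] bounds by (simp add: wp_simps ctx_def)
    qed
    then show ?case
      using regs W_bounds(2,6) by (simp add: wp_simps s2_def del: block.simps)
  qed
qed

lemma wp_diagonal:
  assumes "ctx s" "matrix_at n e (mem s)" "regs s 13 = 0"
  shows "wp W (WhileLess 13 0 diagonal_body) (\<lambda>t s'. t \<le> 7 * n \<and> ctx s' \<and>
    matrix_at n (\<lambda>u w. u = w \<or> e u w) (mem s')) s"
proof -
  define I where "I s' \<longleftrightarrow> ctx s' \<and> regs s' 13 \<le> n \<and>
    matrix_at n (\<lambda>u w. u = w \<and> u < regs s' 13 \<or> e u w) (mem s')" for s' :: state
  have bodyI: "wp W diagonal_body (\<lambda>t s''. t \<le> 5 \<and> I s'' \<and> n - regs s'' 13 < n - regs s' 13) s'"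
    if "I s'" "regs s' 13 < regs s' 0" for s'
  proof -
    define u where "u = regs s' 13"
    have ctx: "ctx s'" and mat: "matrix_at n (\<lambda>x y. x = y \<and> x < u \<or> e x y) (mem s')"
      using that by (simp_all add: I_def u_def)
    have u: "u < n" using that by (simp add: I_def ctx_def u_def)
    have b: "u * n + u < W" "u * n < W" "Suc u < W" "n - Suc u < n - u"
      using index_less[OF u u] u W_bounds by linarith+
    have eq: "(\<lambda>x y. x = y \<and> x < Suc u \<or> e x y) =
        (\<lambda>x y. (x = y \<and> x < u \<or> e x y) \<or> x = u \<and> y = u)"
      by (auto simp: fun_eq_iff less_Suc_eq)
    have "matrix_at n (\<lambda>x y. x = y \<and> x < Suc u \<or> e x y) ((mem s')(u * n + u := 1))"
      unfolding eq using mat u u by (rule matrix_at_set)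
    then show ?thesis
      unfolding diagonal_body_def block.simps
      using ctx b u u_def by (simp add: wp_simps I_def ctx_def)
  qed
  show ?thesis
  proof (rule wp_WhileLess_rule[where I = I and \<mu> = "\<lambda>s. n - regs s 13" and T = 5])
    show "I s" using assms by (simp add: I_def)
  next
    fix t s'
    assume *: "t \<le> (n - regs s 13) * (5 + 1) + 1" "I s'" "\<not> regs s' 13 < regs s' 0"
    then have "regs s' 13 = n" by (simp add: I_def ctx_def)
    then have "matrix_at n (\<lambda>u w. u = w \<or> e u w) (mem s')"
      using *(2) unfolding I_def matrix_at_def by simp
    then show "t \<le> 7 * n \<and> ctx s' \<and> matrix_at n (\<lambda>u w. u = w \<or> e u w) (mem s')"
      using * n assms(3) by (simp add: I_def)
  qed (rule bodyI)
qed

lemma wp_solver: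
  assumes "s = input_state n E k"
  shows "wp W solver (\<lambda>t s'. t \<le> 170 * (card (light_sets n (8 * k)) * n ^ 3) \<and>
    regs s' 0 = of_bool (\<exists>v<n. \<exists>Z. light n (8 * k) Z \<and>
      good n (similar E) k (flip (majority n (similar E) v) Z))) s"
proof -
  define B where "B = card (light_sets n (8 * k))"
  define hit where "hit v \<longleftrightarrow> (\<exists>Z. light n (8 * k) Z \<and>
      good n (similar E) k (flip (majority n (similar E) v) Z))" for v
  define res :: nat where "res = of_bool (\<exists>v<n. hit v)"
  define I where "I s' \<longleftrightarrow> ctx s' \<and> matrix_at n (similar E) (mem s') \<and> regs s' 7 \<le> n \<and>
    regs s' 8 = of_bool (\<exists>v<regs s' 7. hit v)" for s' :: state
  have bodyI: "wp W try_body (\<lambda>t s''. t \<le> 140 * (B * (n * n)) \<and> I s'' \<and>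
      n - regs s'' 7 < n - regs s' 7) s'"
    if "I s'" "regs s' 7 < regs s' 0" for s'
  proof -
    have "ctx s'" "matrix_at n (similar E) (mem s')" "regs s' 7 < n"
        "regs s' 8 = of_bool (\<exists>v<regs s' 7. hit v)"
      using that by (simp_all add: I_def ctx_def)
    from wp_try_body[OF this(1,2) refl this(3,4)]
    show ?thesis
    proof (rule wp_mono, goal_cases)
      case (1 t s'')
      then have "regs s'' 8 = of_bool (\<exists>v<regs s'' 7. hit v)"
        unfolding hit_def[symmetric] by (simp add: Ex_less_Suc disj_commute)
      then show ?case using 1 \<open>regs s' 7 < n\<close> by (simp add: I_def B_def)
    qed
  qed
  have time: "t + t' + 12 \<le> 170 * (B * n ^ 3)"
    if "t \<le> 7 * n" "t' \<le> n * (140 * (B * (n * n)) + 1) + 1" for t t'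
  proof -
    have "1 * 1 \<le> B * n ^ 3" "1 * n \<le> B * n ^ 3"
      using card_light_sets_pos[of n "8 * k"] n self_le_power[of n 3] unfolding B_def[symmetric]
      by (intro mult_le_mono; simp)+
    moreover have "n * (140 * (B * (n * n)) + 1) + 1 = 140 * (B * n ^ 3) + n + 1"
      by (simp add: distrib_left power3_eq_cube)
    ultimately show ?thesis using that by linarith
  qed
  define s1 where "s1 = s\<lparr>regs := (\<lambda>_. 0)(0 := n, 1 := k, 3 := 1, 4 := n * n, 18 := 8,
    5 := 8 * k, 6 := n * n + n, 13 := 0)\<rparr>"
  have ctx1: "ctx s1" by (simp add: ctx_def s1_def)
  have mat1: "matrix_at n (\<lambda>u w. {u, w} \<in> E) (mem s1)"
    unfolding matrix_at_def
  proof (intro allI impI)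
    fix u w assume uw: "u < n" "w < n"
    then have "(u * n + w) div n = u" "(u * n + w) mod n = w" by simp_all
    then show "mem s1 (u * n + w) = of_bool ({u, w} \<in> E)"
      using index_less[OF uw] by (simp add: s1_def assms input_state_def)
  qed
  have "wp W (WhileLess 13 0 diagonal_body) (\<lambda>t1. wp W (Do (Const 7 0)) (\<lambda>t2. wp W (Do (Const 8 0))
      (\<lambda>t3. wp W (WhileLess 7 0 try_body) (\<lambda>t4. wp W (Do (Add 0 8 2)) (\<lambda>t5. wp W Skip
        (\<lambda>t6 s'. Suc (Suc (Suc (Suc (Suc (Suc (t1 + (t2 + (t3 + (t4 + (t5 + t6)))))))))) \<le> 170 * (B * n ^ 3) \<and>
          regs s' 0 = res)))))) s1"
  proof (rule wp_mono[OF wp_diagonal[OF ctx1 mat1]], goal_cases)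
    case 1 show ?case by (simp add: s1_def)
  next
    case (2 t1 s2)
    define s3 where "s3 = s2\<lparr>regs := (regs s2)(7 := 0, 8 := 0)\<rparr>"
    have t1: "t1 \<le> 7 * n" using 2 by simp
    have "similar E = (\<lambda>u w. u = w \<or> {u, w} \<in> E)" by (simp add: fun_eq_iff similar_def)
    then have "I s3" using 2 by (simp add: I_def ctx_def s3_def)
    have "wp W (WhileLess 7 0 try_body) (\<lambda>t4. wp W (Do (Add 0 8 2)) (\<lambda>t5. wp W Skip
        (\<lambda>t6 s'. Suc (Suc (Suc (Suc (Suc (Suc (Suc (Suc (t1 + (t4 + (t5 + t6)))))))))) \<le> 170 * (B * n ^ 3) \<and>
          regs s' 0 = res))) s3"
    proof (rule wp_WhileLess_rule[where I = I and \<mu> = "\<lambda>s. n - regs s 7" and T = "140 * (B * (n * n))"])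
      fix t s'
      assume *: "t \<le> (n - regs s3 7) * (140 * (B * (n * n)) + 1) + 1" "I s'"
        "\<not> regs s' 7 < regs s' 0"
      have "t \<le> n * (140 * (B * (n * n)) + 1) + 1" using *(1) by (simp add: s3_def)
      from time[OF t1 this] have "8 + (t1 + (t + (1 + 1))) \<le> 170 * (B * n ^ 3)"
        by linarith
      moreover have "regs s' 7 = n" using *(2,3) by (simp add: I_def ctx_def)
      then have "regs s' 8 = res" "regs s' 2 = 0" using *(2) by (simp_all add: I_def res_def ctx_def)
      moreover have "res < W" using W_bounds(6,11) by (simp add: res_def)
      ultimately show "wp W (Do (Add 0 8 2)) (\<lambda>t5. wp W Skip
        (\<lambda>t6 s'. Suc (Suc (Suc (Suc (Suc (Suc (Suc (Suc (t1 + (t + (t5 + t6)))))))))) \<le> 170 * (B * n ^ 3) \<and>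
          regs s' 0 = res)) s'"
        by (simp add: wp_simps)
    qed (use \<open>I s3\<close> bodyI in auto)
    then show ?case using W_bounds(11) by (simp add: wp_simps s3_def)
  qed
  then show ?thesis
    unfolding solver_def block.simps hit_def[symmetric] B_def[symmetric] res_def[symmetric] wp_Seq
    using W_bounds(2,5,6,7,8,11)
    by (simp add: wp_simps s1_def assms input_state_def mult.commute[of k 8])
qed

end

section \<open>The number of light sets\<close>

text \<open>The binomial theorem, summed over subsets: each element contributes a factor 1 or
  \<open>x\<close>.\<close>

lemma sum_power_card_Pow:
  fixes x :: real
  assumes "finite A"
  shows "(\<Sum>X\<in>Pow A. x ^ card X) = (1 + x) ^ card A"
  using assms
proof (induction A)
  case (insert b A)
  have inj: "inj_on (insert b) (Pow A)"
    using insert.hyps(2) by (auto simp: inj_on_def)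
  have disj: "Pow A \<inter> insert b ` Pow A = {}"
    using insert.hyps(2) by auto
  have "(\<Sum>X\<in>insert b ` Pow A. x ^ card X) = (\<Sum>X\<in>Pow A. x * x ^ card X)"
    unfolding sum.reindex[OF inj] o_def
  proof (rule sum.cong)
    fix X assume "X \<in> Pow A"
    then have "finite X" "b \<notin> X" using insert.hyps finite_subset by auto
    then show "x ^ card (insert b X) = x * x ^ card X" by simp
  qed simp
  then have "(\<Sum>X\<in>Pow (insert b A). x ^ card X) = (1 + x) * (\<Sum>X\<in>Pow A. x ^ card X)"
    unfolding Pow_insert using insert.hyps(1) disj
    by (simp add: sum.union_disjoint sum_distrib_left[symmetric] algebra_simps)
  then show ?case using insert by simp
qed simp

text \<open>Dividing the total weight by the least weight of a light set, as in Markov's inequality,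
  bounds their number. With \<open>K = 8 * k\<close> the hypothesis on \<open>K\<close> says that
  \<open>x\<close> is \<open>\<theta> / n\<close>.\<close>

lemma card_light_sets_le:
  fixes x :: real
  assumes "n > 0" "0 < x" "x \<le> 1" and K: "real K = 8 * x\<^sup>2 * real n * (real n)\<^sup>2"
  shows "real (card (light_sets n K)) \<le> exp (real n * x + 8 * x\<^sup>2 * real n * ln (1 / x))"
proof -
  have "x powr (8 * x\<^sup>2 * real n) \<le> x ^ card X" if "X \<in> light_sets n K" for X
  proof -
    have "real (card X * (n * n)) \<le> real K"
      using that by (simp add: light_sets_def light_def del: of_nat_mult)
    then have "real (card X) * (real n)\<^sup>2 \<le> (8 * x\<^sup>2 * real n) * (real n)\<^sup>2"
      using K by (simp add: power2_eq_square)
    then have "real (card X) \<le> 8 * x\<^sup>2 * real n"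
      using \<open>n > 0\<close> by simp
    then have "x powr (8 * x\<^sup>2 * real n) \<le> x powr real (card X)"
      using assms(2,3) by (intro powr_mono') auto
    then show ?thesis using \<open>0 < x\<close> by (simp add: powr_realpow)
  qed
  then have "(\<Sum>X\<in>light_sets n K. x powr (8 * x\<^sup>2 * real n)) \<le> (\<Sum>X\<in>light_sets n K. x ^ card X)"
    by (rule sum_mono)
  also have "\<dots> \<le> (\<Sum>X\<in>Pow {..<n}. x ^ card X)"
    using \<open>0 < x\<close> by (intro sum_mono2) (auto simp: light_sets_def light_def)
  also have "\<dots> = (1 + x) ^ n" by (simp add: sum_power_card_Pow)
  also have "\<dots> \<le> exp x ^ n"
    using \<open>0 < x\<close> by (intro power_mono exp_ge_add_one_self) auto
  also have "\<dots> = exp (real n * x)" by (simp add: exp_of_nat_mult)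
  finally have "real (card (light_sets n K)) * x powr (8 * x\<^sup>2 * real n) \<le> exp (real n * x)"
    by simp
  moreover have "x powr (8 * x\<^sup>2 * real n) = inverse (exp (8 * x\<^sup>2 * real n * ln (1 / x)))"
    using \<open>0 < x\<close> by (simp add: powr_def ln_div flip: exp_minus)
  ultimately have "real (card (light_sets n K)) \<le>
      exp (real n * x) * exp (8 * x\<^sup>2 * real n * ln (1 / x))"
    by (simp add: divide_inverse[symmetric] pos_divide_le_eq)
  then show ?thesis by (simp add: exp_add)
qed

text \<open>The logarithm is replaced by its tangent at \<open>1 / x = 16\<close>.\<close>

lemma exponent_bound:
  fixes x :: real
  assumes "0 < x" "x \<le> 0.145"
  shows "1 + 8 * x * ln (1 / x) \<le> 1.56 / (1 - (4 + 2 * sqrt 2) * x)"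
proof -
  \<comment> \<open>Here 0.035625 * 20 * 4 = 2.85, a rational bound slightly above
    \<open>ln 16\<close>, which is about 2.773.\<close>
  have "2 \<le> (1 + 0.035625 :: real) ^ 20" by (simp add: power_divide)
  also have "\<dots> \<le> exp 0.035625 ^ 20" by (intro power_mono exp_ge_add_one_self) simp
  also have "\<dots> = exp 0.7125" by (simp flip: exp_of_nat_mult)
  finally have "(2::real) ^ 4 \<le> exp 0.7125 ^ 4" by (rule power_mono) simp
  then have "16 \<le> exp (2.85 :: real)" by (simp flip: exp_of_nat_mult)
  then have ln16: "ln (16 :: real) \<le> 2.85"
    using ln_le_cancel_iff[of 16 "exp (2.85::real)"] by simp
  have "ln (1 / x) = ln (1 / (16 * x)) + ln 16"
    using assms(1) by (simp add: ln_div ln_mult)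
  also have "ln (1 / (16 * x)) \<le> 1 / (16 * x) - 1"
    using assms(1) by (intro ln_le_minus_one) simp
  finally have "ln (1 / x) \<le> 1 / (16 * x) + 1.85" using ln16 by simp
  then have "8 * x * ln (1 / x) \<le> 8 * x * (1 / (16 * x) + 1.85)"
    using assms(1) by (intro mult_left_mono) auto
  also have "\<dots> = 0.5 + 14.8 * x"
    using assms(1) by (simp add: field_simps)
  finally have 1: "1 + 8 * x * ln (1 / x) \<le> 1.5 + 14.8 * x" by simp
  have s: "1.4 \<le> sqrt 2" "sqrt 2 \<le> 1.42"
    by (rule real_le_rsqrt real_le_lsqrt; simp add: power2_eq_square)+
  \<comment> \<open>The upper bound keeps the denominator positive, as 6.84 * 0.145 = 0.9918; the
    lower one turns the claim into a rational quadratic inequality.\<close>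
  have "(4 + 2 * sqrt 2) * x \<le> 6.84 * x" "6.8 * x \<le> (4 + 2 * sqrt 2) * x"
    using s assms(1) by (intro mult_right_mono; simp)+
  then have d: "0 < 1 - (4 + 2 * sqrt 2) * x" "1 - (4 + 2 * sqrt 2) * x \<le> 1 - 6.8 * x"
    using assms(2) by auto
  \<comment> \<open>The parabola on the left of the next claim has its vertex near 0.0228, with
    value about 1.553.\<close>
  have "0 \<le> (x - 0.0228)\<^sup>2" by simp
  then have "(1.5 + 14.8 * x) * (1 - 6.8 * x) \<le> 1.56"
    using assms by (simp add: power2_eq_square algebra_simps)
  moreover have "(1.5 + 14.8 * x) * (1 - (4 + 2 * sqrt 2) * x) \<le> (1.5 + 14.8 * x) * (1 - 6.8 * x)"
    using d assms(1) by (intro mult_left_mono) auto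
  ultimately have "1.5 + 14.8 * x \<le> 1.56 / (1 - (4 + 2 * sqrt 2) * x)"
    using d(1) by (subst pos_le_divide_eq) auto
  then show ?thesis using 1 by linarith
qed

text \<open>Since 39 * 0.04 = 1.56, it suffices that the 39th power of 1/0.96, about 4.91, stays
  below 5.171.\<close>

lemma ln_base_ge: "1.56 \<le> ln (5.171 :: real)"
proof -
  have "exp (0.04 :: real) ^ 39 \<le> (1 / (1 - 0.04)) ^ 39"
  proof (rule power_mono)
    have "1 - 0.04 \<le> exp (- 0.04 :: real)" using exp_ge_add_one_self[of "- 0.04"] by simp
    then show "exp (0.04 :: real) \<le> 1 / (1 - 0.04)"
      by (simp add: exp_minus field_simps)
  qed simp
  also have "\<dots> \<le> 5.171" by (simp add: power_divide)
  finally have "exp (1.56 :: real) \<le> 5.171"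
    by (simp flip: exp_of_nat_mult)
  then show ?thesis by (subst ln_ge_iff) simp_all
qed

lemma card_light_sets_bound:
  fixes \<theta> :: real
  assumes "n > 0" "real k \<le> 0.021 * real n ^ 3" "\<theta> = sqrt (real k / real n)"
  shows "real (card (light_sets n (8 * k))) \<le>
    5.171 powr (\<theta> / (1 - (4 + 2 * sqrt 2) * \<theta> / real n))"
proof (cases "k = 0")
  \<comment> \<open>With \<open>k = 0\<close> the parameter \<open>x\<close> would be 0 and its
    logarithm useless; only the empty set is light, and both sides are 1.\<close>
  case True
  have "light_sets n (8 * k) = {{}}"
    using assms(1) True finite_subset[of _ "{..<n}"] by (auto simp: light_sets_def light_def)
  then show ?thesis using True assms(3) by simp
next
  case False
  define x where "x = \<theta> / real n"
  have pos: "0 < \<theta>" using assms(1,3) False by simp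
  then have x0: "0 < x" using assms(1) by (simp add: x_def)
  have th2: "\<theta>\<^sup>2 = real k / real n" using assms(3) by simp
  have "\<theta>\<^sup>2 \<le> 0.021 * (real n)\<^sup>2"
    unfolding th2 using assms(1,2) by (simp add: field_simps power2_eq_square power3_eq_cube)
  also have "\<dots> \<le> (0.145 * real n)\<^sup>2"
    by (simp add: power_mult_distrib) (simp add: power2_eq_square)
  finally have "\<theta> \<le> 0.145 * real n" by (rule power2_le_imp_le) simp
  then have x1: "x \<le> 0.145" using assms(1) by (simp add: x_def field_simps)
  have "x\<^sup>2 * real n * (real n)\<^sup>2 = \<theta>\<^sup>2 * real n"
    using assms(1) by (simp add: x_def power_divide)
  then have K: "real (8 * k) = 8 * x\<^sup>2 * real n * (real n)\<^sup>2"
    using th2 assms(1) by simp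
  have "real (card (light_sets n (8 * k))) \<le>
      exp (real n * x + 8 * x\<^sup>2 * real n * ln (1 / x))"
    using assms(1) x0 _ K by (rule card_light_sets_le) (use x1 in simp)
  also have "real n * x + 8 * x\<^sup>2 * real n * ln (1 / x) = \<theta> * (1 + 8 * x * ln (1 / x))"
    using assms(1) by (simp add: x_def power2_eq_square algebra_simps)
  also have "exp (\<theta> * (1 + 8 * x * ln (1 / x))) \<le> exp (\<theta> * (1.56 / (1 - (4 + 2 * sqrt 2) * x)))"
    unfolding exp_le_cancel_iff using exponent_bound[OF x0 x1]
    by (rule mult_left_mono) (use pos in simp)
  also have "\<dots> \<le> exp (\<theta> / (1 - (4 + 2 * sqrt 2) * x) * ln 5.171)"
  proof -
    have "0 \<le> 1 - (4 + 2 * sqrt 2) * x"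
    proof -
      have "sqrt 2 \<le> 1.42" by (rule real_le_lsqrt) (simp_all add: power2_eq_square)
      then have "(4 + 2 * sqrt 2) * x \<le> 6.84 * 0.145"
        using x0 x1 by (intro mult_mono) auto
      then show ?thesis by simp
    qed
    then have "0 \<le> \<theta> / (1 - (4 + 2 * sqrt 2) * x)" using pos by simp
    then have "\<theta> / (1 - (4 + 2 * sqrt 2) * x) * 1.56 \<le> \<theta> / (1 - (4 + 2 * sqrt 2) * x) * ln 5.171"
      using ln_base_ge by (rule mult_left_mono[rotated])
    moreover have "\<theta> * (1.56 / D) = \<theta> / D * 1.56" for D :: real by simp
    ultimately show ?thesis by (simp only: exp_le_cancel_iff)
  qed
  also have "\<dots> = 5.171 powr (\<theta> / (1 - (4 + 2 * sqrt 2) * \<theta> / real n))"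
    by (simp add: powr_def x_def)
  finally show ?thesis .
qed

theorem theorem2:
  "\<exists>(p :: prog) (b :: nat) (C :: real). \<forall>(n :: nat) (E :: nat set set) (k :: nat) (\<theta> :: real).
     n > 0 \<longrightarrow> simple_graph {0..<n} E \<longrightarrow> real k \<le> 0.021 * real n ^ 3 \<longrightarrow>
     \<theta> = sqrt (real k / real n) \<longrightarrow>
     decides_within ((n + 1) ^ b) p (input_state n E k)
       (min_square_2_clustering {0..<n} E k)
       (C * (real n ^ 3 * 5.171 powr (\<theta> / (1 - (4 + 2 * sqrt 2) * \<theta> / real n))))"
proof (intro exI allI impI)
  fix n k :: nat and E :: "nat set set" and \<theta> :: real
  assume pos: "n > 0" and k_le: "real k \<le> 0.021 * real n ^ 3" and \<theta>: "\<theta> = sqrt (real k / real n)"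
  \<comment> \<open>Half of the exponent pays for the constant, as
    \<open>(n + 1) ^ 3 \<ge> 8\<close> for \<open>n > 0\<close>. The witnesses are 6 for
    \<open>b\<close> and 170 for \<open>C\<close>.\<close>
  let ?W = "(n + 1) ^ 6"
  have "(2::nat) ^ 3 \<le> (n + 1) ^ 3" using pos by (intro power_mono) simp_all
  then have "8 * (n + 1) ^ 3 \<le> (n + 1) ^ 3 * (n + 1) ^ 3"
    by (intro mult_le_mono1) simp
  then have W: "8 * (n + 1) ^ 3 \<le> ?W"
    by (simp flip: power_add)
  have "real (8 * k) \<le> real (n ^ 3)" using k_le by simp
  then have k8: "8 * k \<le> n ^ 3" by (simp only: of_nat_le_iff)
  interpret ram n k ?W using pos W k8 by unfold_locales
  let ?hit = "\<exists>v<n. \<exists>Z. light n (8 * k) Z \<and>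
    good n (similar E) k (flip (majority n (similar E) v) Z)"
  \<comment> \<open>A hit is itself a good partition, so the correction lemma is needed only for
    completeness of the search.\<close>
  have hit: "?hit \<longleftrightarrow> min_square_2_clustering {0..<n} E k"
    unfolding min_square_iff_good using exists_light_correction[OF pos _ k_le] by blast
  obtain t s' where run: "exec ?W solver (input_state n E k) t s'"
      "t \<le> 170 * (card (light_sets n (8 * k)) * n ^ 3)" "regs s' 0 = of_bool ?hit"
    using wp_solver[OF refl] unfolding wp_def by blast
  have "real t \<le> real (170 * (card (light_sets n (8 * k)) * n ^ 3))"
    using run(2) by (simp only: of_nat_le_iff)
  also have "\<dots> = 170 * (real n ^ 3 * real (card (light_sets n (8 * k))))"
    by simp
  also have "\<dots> \<le> 170 * (real n ^ 3 * 5.171 powr (\<theta> / (1 - (4 + 2 * sqrt 2) * \<theta> / real n)))"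
    using card_light_sets_bound[OF pos k_le \<theta>] by (intro mult_left_mono) simp_all
  finally have time: "real t \<le> \<dots>" .
  have "n < ?W" "k < ?W" "1 < ?W" "0 < ?W"
    using W_bounds by linarith+
  then have "\<forall>i. regs (input_state n E k) i < ?W \<and> mem (input_state n E k) i < ?W"
    by (simp add: input_state_def del: power_Suc)
  moreover have "regs s' 0 = (if min_square_2_clustering {0..<n} E k then 1 else 0)"
    unfolding run(3) hit by simp
  ultimately show "decides_within ?W solver (input_state n E k)
      (min_square_2_clustering {0..<n} E k)
      (170 * (real n ^ 3 * 5.171 powr (\<theta> / (1 - (4 + 2 * sqrt 2) * \<theta> / real n))))"
    unfolding decides_within_def using run(1) time by blast
qed

end
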